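(* Let $\mu$ be a finite Borel measure on $\mathbb{R}/\mathbb{Z}$ satisfying $\mu(A)=\mu(-A)$ for all Borel $A\subseteq\mathbb{R}/\mathbb{Z}$. Then the following hold. (i) If $1\le N<\#\operatorname{supp}(\mu)$, then $$\rho(\mu,N)=\theta_1,$$ where $0\le\theta_1\le 1/2$ is such that $e^{2\pi i\theta_1}$ is a zero of $A_{N+1}(z;d\mu)$ at minimal distance from the point $1\in\partial\mathbb{D}$, i.e. $$\theta_1=\min\{|\theta| : A_{N+1}(e^{2\pi i\theta};d\mu)=0\}.$$ Moreover, the extremizer (a function $0\not\equiv f\in\mathcal{T}(\mu,N)$ with $\mathrm{r}(f)=\rho(\mu,N)$) is unique up to a constant factor and is given by $$f(x)=\frac{|A_{N+1}(e^{2\pi i x};d\mu)|^2}{\cos(2\pi\theta_1)-\cos(2\pi x)}.$$ (ii) If $N\geq 1$ and $\#\operatorname{supp}(\mu)\le N<\infty$, then $\rho(\mu,N)=0$.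
   Context: For $x\in\mathbb{R}/\mathbb{Z}$, $|x|$ denotes the distance from $x$ to $0$ in $\mathbb{R}/\mathbb{Z}$ (so $|x|\le 1/2$), and $B_r(0)=\{x:|x|<r\}$. A function $f:\mathbb{R}/\mathbb{Z}\to\mathbb{R}$ is eventually non-negative if there is $r>0$ with $f(x)\ge0$ for all $x\notin B_r(0)$; its radius of last sign change is $$\mathrm{r}(f)=\inf\{r>0: f(x)\ge 0\text{ for all }x\in(\mathbb{R}/\mathbb{Z})\setminus B_r(0)\}.$$ For $N\ge1$, $\mathcal{T}(\mu,N)$ is the set of trigonometric polynomials $f(x)=\sum_{n=-N}^N\widehat f(n)e^{2\pi i n x}$ that are real-valued, eventually non-negative and satisfy $\int_{\mathbb{R}/\mathbb{Z}} f\,d\mu\le0$. Set $$\rho(\mu,N)=\inf_{0\not\equiv f\in\mathcal{T}(\mu,N)}\mathrm{r}(f).$$ Let $\mathbb{D}=\{|z|<1\}$, $\partial\mathbb{D}=\{|z|=1\}$. A measure $\mu$ on $\mathbb{R}/\mathbb{Z}$ is identified with a measure on $\partial\mathbb{D}$ via $\theta\mapsto e^{2\pi i\theta}$. For a probability measure $\mu$ on $\partial\mathbb{D}$, the monic orthogonal polynomials $\Phi_n(z)=\Phi_n(z;d\mu)$ (of degree $n$, orthogonal to $1,z,\dots,z^{n-1}$ in $L^2(\partial\mathbb{D},d\mu)$) and the orthonormal polynomials $\varphi_n=\Phi_n/\|\Phi_n\|_{L^2(d\mu)}$ are well defined for all integers $0\le n<\#\operatorname{supp}(\mu)$. For a polynomial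 $P$ of degree $n$ put $P^*(z)=z^n\overline{P(1/\overline z)}$. Define $$A_n(z;d\mu)=\tfrac12\big(\varphi_n(z;d\mu)+\varphi_n^*(z;d\mu)\big)\quad\text{if } n<\#\operatorname{supp}(\mu),$$ $$A_n(z;d\mu)=\tfrac12\big(z\varphi_{n-1}(z;d\mu)+\varphi_{n-1}^*(z;d\mu)\big)\quad\text{if } n=\#\operatorname{supp}(\mu).$$ For a nonzero finite measure $\mu$ that is not a probability measure, $A_n(z;d\mu)$ means the polynomial associated with the normalized measure $\mu/\mu(\mathbb{R}/\mathbb{Z})$ (one has $\rho(c\mu,N)=\rho(\mu,N)$ for $c>0$). The quotient defining the extremizer is understood at $x=\pm\theta_1$ by continuous extension. *)

theory Defs
  imports
    "HOL-Analysis.Analysis"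
    "HOL-Computational_Algebra.Polynomial"
    "HOL-Library.Extended_Nat"
begin

definition cong_one :: "real \<Rightarrow> real \<Rightarrow> bool" where
  "cong_one s t \<longleftrightarrow> s - t \<in> \<int>"

lemma equivp_cong_one: "equivp cong_one"
proof (rule equivpI)
  show "reflp cong_one" by (auto simp: reflp_def cong_one_def)
  show "symp cong_one"
    unfolding symp_def cong_one_def using Ints_minus minus_diff_eq by metis
  show "transp cong_one"
    unfolding transp_def cong_one_def
  proof (intro allI impI)
    fix x y z :: real
    assume "x - y \<in> \<int>" "y - z \<in> \<int>"
    then have "(x - y) + (y - z) \<in> \<int>" by (rule Ints_add)
    then show "x - z \<in> \<int>" by simp
  qed
qed

quotient_type add_circle = real / cong_one
  morphisms rep_circle to_circle
  by (rule equivp_cong_one)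

instantiation add_circle :: ab_group_add
begin

lift_definition zero_add_circle :: add_circle is "0 :: real" .

lift_definition plus_add_circle :: "add_circle \<Rightarrow> add_circle \<Rightarrow> add_circle"
  is "\<lambda>s t :: real. s + t"
  unfolding cong_one_def using Ints_add by (metis add_diff_add)

lift_definition uminus_add_circle :: "add_circle \<Rightarrow> add_circle"
  is "\<lambda>t :: real. - t"
  unfolding cong_one_def using Ints_minus by (metis minus_diff_minus)

lift_definition minus_add_circle :: "add_circle \<Rightarrow> add_circle \<Rightarrow> add_circle"
  is "\<lambda>s t :: real. s - t"
  unfolding cong_one_def
proof -
  fix a b c d :: real
  assume "a - b \<in> \<int>" "c - d \<in> \<int>"
  then have "(a - b) - (c - d) \<in> \<int>" by (rule Ints_diff)
  then show "a - c - (b - d) \<in> \<int>" by (simp add: algebra_simps)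
qed

instance
  by standard (transfer, simp add: cong_one_def algebra_simps)+

end

text \<open>Distance from a real number to the nearest integer.\<close>

definition int_dist :: "real \<Rightarrow> real" where
  "int_dist t = \<bar>t - of_int (round t)\<bar>"

lemma int_dist_le: "int_dist t \<le> \<bar>t - of_int m\<bar>"
  unfolding int_dist_def by (rule round_diff_minimal)

lemma int_dist_add_le: "int_dist (s + t) \<le> int_dist s + int_dist t"
proof -
  have "int_dist (s + t) \<le> \<bar>s + t - of_int (round s + round t)\<bar>"
    by (rule int_dist_le)
  also have "\<dots> \<le> int_dist s + int_dist t"
    unfolding int_dist_def by simp
  finally show ?thesis .
qed

lemma int_dist_uminus: "int_dist (- t) = int_dist t"
proof -
  have le: "int_dist (- t) \<le> int_dist t" for t
    using int_dist_le[of "- t" "- round t"] by (simp add: int_dist_def abs_minus_commute)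
  show ?thesis using le[of t] le[of "- t"] by simp
qed

lemma int_dist_eq_0_iff: "int_dist t = 0 \<longleftrightarrow> t \<in> \<int>"
proof
  assume "int_dist t = 0"
  then have "t = of_int (round t)" by (simp add: int_dist_def)
  then show "t \<in> \<int>" by (metis Ints_of_int)
next
  assume "t \<in> \<int>"
  then show "int_dist t = 0" by (auto elim!: Ints_cases simp: int_dist_def)
qed

lemma int_dist_cong:
  assumes "s - t \<in> \<int>"
  shows "int_dist s = int_dist t"
proof -
  have "int_dist s \<le> int_dist t" if "s - t \<in> \<int>" for s t
    using int_dist_add_le[of "s - t" t] int_dist_eq_0_iff[of "s - t"] that by simp
  moreover have "t - s \<in> \<int>" using assms by (metis Ints_minus minus_diff_eq)
  ultimately show ?thesis using assms by (meson order_antisym)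
qed

text \<open>
  The quotient metric; \<open>dist x 0\<close> is the distance of \<open>x\<close> to \<open>0\<close> written \<open>\<bar>x\<bar>\<close> in
  the literature, so it is at most \<open>1/2\<close>.
\<close>

instantiation add_circle :: metric_space
begin

lift_definition dist_add_circle :: "add_circle \<Rightarrow> add_circle \<Rightarrow> real"
  is "\<lambda>s t. int_dist (s - t)"
proof -
  fix a b c d :: real
  assume "cong_one a b" "cong_one c d"
  then have "(a - b) - (c - d) \<in> \<int>" unfolding cong_one_def by (rule Ints_diff)
  then have "(a - c) - (b - d) \<in> \<int>" by (simp add: algebra_simps)
  then show "int_dist (a - c) = int_dist (b - d)" by (rule int_dist_cong)
qed

definition uniformity_add_circle :: "(add_circle \<times> add_circle) filter" where
  "uniformity_add_circle = (INF e\<in>{0<..}. principal {(x, y). dist x y < e})"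

definition open_add_circle :: "add_circle set \<Rightarrow> bool" where
  "open_add_circle U \<longleftrightarrow> (\<forall>x\<in>U. \<forall>\<^sub>F (x', y) in uniformity. x' = x \<longrightarrow> y \<in> U)"

instance
proof
  fix x y z :: add_circle
  show "(dist x y = 0) = (x = y)"
    by transfer (simp add: cong_one_def int_dist_eq_0_iff)
  show "dist x y \<le> dist x z + dist y z"
  proof transfer
    fix a b c :: real
    show "int_dist (a - b) \<le> int_dist (a - c) + int_dist (b - c)"
      using int_dist_add_le[of "a - c" "c - b"] int_dist_uminus[of "b - c"] by simp
  qed
qed (simp_all add: uniformity_add_circle_def open_add_circle_def)

end

lift_definition circle_exp :: "add_circle \<Rightarrow> complex" is "\<lambda>t. cis (2 * pi * t)"
proof -
  fix s t :: real
  assume "cong_one s t"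
  then obtain k :: int where "s - t = of_int k" unfolding cong_one_def by (auto elim: Ints_cases)
  then have "s = t + of_int k" by simp
  then have "cis (2 * pi * s) = cis (2 * pi * t) * cis (2 * pi * of_int k)"
    by (simp add: cis_mult algebra_simps)
  also have "cis (2 * pi * of_int k) = 1" by (rule cis_multiple_2pi) simp
  finally show "cis (2 * pi * s) = cis (2 * pi * t)" by simp
qed

definition circle_cos :: "add_circle \<Rightarrow> real" where
  "circle_cos x = Re (circle_exp x)"

lemma circle_cos_to_circle: "circle_cos (to_circle t) = cos (2 * pi * t)"
  by (simp add: circle_cos_def circle_exp.abs_eq)

definition eventually_nonneg :: "(add_circle \<Rightarrow> real) \<Rightarrow> bool" where
  "eventually_nonneg f \<longleftrightarrow> (\<exists>r>0. \<forall>x. x \<notin> ball 0 r \<longrightarrow> f x \<ge> 0)"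

definition last_sign_change :: "(add_circle \<Rightarrow> real) \<Rightarrow> real" where
  "last_sign_change f = Inf {r. r > 0 \<and> (\<forall>x. x \<notin> ball 0 r \<longrightarrow> f x \<ge> 0)}"

definition trig_poly :: "nat \<Rightarrow> (add_circle \<Rightarrow> real) \<Rightarrow> bool" where
  "trig_poly N f \<longleftrightarrow>
     (\<exists>c :: int \<Rightarrow> complex. \<forall>x.
        complex_of_real (f x) = (\<Sum>n\<in>{- int N..int N}. c n * circle_exp x powi n))"

definition admissible :: "add_circle measure \<Rightarrow> nat \<Rightarrow> (add_circle \<Rightarrow> real) set" where
  "admissible \<mu> N = {f. trig_poly N f \<and> eventually_nonneg f \<and> (LINT x|\<mu>. f x) \<le> 0}"

definition rho :: "add_circle measure \<Rightarrow> nat \<Rightarrow> real" where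
  "rho \<mu> N = Inf (last_sign_change ` (admissible \<mu> N - {\<lambda>_. 0}))"

definition extremizer :: "add_circle measure \<Rightarrow> nat \<Rightarrow> (add_circle \<Rightarrow> real) \<Rightarrow> bool" where
  "extremizer \<mu> N f \<longleftrightarrow>
     f \<in> admissible \<mu> N - {\<lambda>_. 0} \<and> last_sign_change f = rho \<mu> N"

definition msupp :: "'a::topological_space measure \<Rightarrow> 'a set" where
  "msupp M = {x. \<forall>U. open U \<longrightarrow> x \<in> U \<longrightarrow> emeasure M U > 0}"

definition supp_size :: "'a::topological_space measure \<Rightarrow> enat" where
  "supp_size M = (if finite (msupp M) then enat (card (msupp M)) else \<infinity>)"

text \<open>
  Measures on the unit circle are represented as Borel measures on \<open>\<complex>\<close> that
  are carried by the unit circle.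
\<close>

definition circle_measure :: "add_circle measure \<Rightarrow> complex measure" where
  "circle_measure \<mu> = distr \<mu> borel circle_exp"

definition normalize_measure :: "'a measure \<Rightarrow> 'a measure" where
  "normalize_measure M = scale_measure (inverse (emeasure M (space M))) M"

text \<open>
  \<open>monic_OP \<nu> n\<close> and \<open>orthonormal_OP \<nu> n\<close> are meaningful only for
  \<open>n < supp_size \<nu>\<close>, where the polynomial described exists uniquely.
\<close>

definition monic_OP :: "complex measure \<Rightarrow> nat \<Rightarrow> complex poly" where
  "monic_OP \<nu> n =
     (THE P. degree P = n \<and> lead_coeff P = 1 \<and>
        (\<forall>k<n. (LINT z|\<nu>. poly P z * cnj (z ^ k)) = 0))"

definition L2_norm_poly :: "complex measure \<Rightarrow> complex poly \<Rightarrow> real" where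
  "L2_norm_poly \<nu> P = sqrt (LINT z|\<nu>. (cmod (poly P z))\<^sup>2)"

definition orthonormal_OP :: "complex measure \<Rightarrow> nat \<Rightarrow> complex poly" where
  "orthonormal_OP \<nu> n =
     smult (complex_of_real (1 / L2_norm_poly \<nu> (monic_OP \<nu> n))) (monic_OP \<nu> n)"

definition star_poly :: "complex poly \<Rightarrow> complex poly" where
  "star_poly P = reflect_poly (map_poly cnj P)"

lemma poly_star_poly:
  assumes "z \<noteq> 0"
  shows "poly (star_poly P) z = z ^ degree P * cnj (poly P (1 / cnj z))"
proof -
  have "degree (map_poly cnj P) = degree P" by (rule degree_map_poly) simp
  then show ?thesis
    using assms by (simp add: star_poly_def poly_reflect_poly_nz inverse_eq_divide)
qed

definition A_poly_prob :: "complex measure \<Rightarrow> nat \<Rightarrow> complex poly" where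
  "A_poly_prob \<nu> n =
     (if enat n < supp_size \<nu> then
        smult (1 / 2) (orthonormal_OP \<nu> n + star_poly (orthonormal_OP \<nu> n))
      else if enat n = supp_size \<nu> then
        smult (1 / 2) (pCons 0 (orthonormal_OP \<nu> (n - 1)) + star_poly (orthonormal_OP \<nu> (n - 1)))
      else undefined)"

definition A_poly :: "add_circle measure \<Rightarrow> nat \<Rightarrow> complex poly" where
  "A_poly \<mu> n = A_poly_prob (normalize_measure (circle_measure \<mu>)) n"

definition extremal_quotient ::
  "add_circle measure \<Rightarrow> nat \<Rightarrow> real \<Rightarrow> add_circle \<Rightarrow> real" where
  "extremal_quotient \<mu> N \<theta> x =
     (cmod (poly (A_poly \<mu> (N + 1)) (circle_exp x)))\<^sup>2 / (cos (2 * pi * \<theta>) - circle_cos x)"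

text \<open>
  The continuous extension to \<open>\<plusminus>\<theta>\<close>, where the denominator vanishes.
\<close>

definition extremal_fun ::
  "add_circle measure \<Rightarrow> nat \<Rightarrow> real \<Rightarrow> add_circle \<Rightarrow> real" where
  "extremal_fun \<mu> N \<theta> x =
     (if x = to_circle \<theta> \<or> x = - to_circle \<theta>
      then Lim (at x) (extremal_quotient \<mu> N \<theta>)
      else extremal_quotient \<mu> N \<theta> x)"

end

theory Submission
  imports Defs "HOL-Computational_Algebra.Fundamental_Theorem_Algebra"
begin

text \<open>
  Let \<open>B = A_poly \<mu> (N + 1)\<close>. A trigonometric polynomial of degree at most \<open>N\<close> is
  \<open>G z / z ^ N\<close> on the circle, with a polynomial \<open>G\<close> of degree at most \<open>2 * N\<close>. The theorem
  compares the roots of such \<open>G\<close> with those of \<open>B\<close>.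
  
  The polynomial \<open>B\<close> is para-orthogonal: it equals its reversal, and it is orthogonal to
  \<open>z, \<dots>, z ^ N\<close>. If it had a root \<open>a\<close> together with the mirror image \<open>1 / cnj a\<close> (that is, a
  root off the circle or a double root on it), then on the circle \<open>B\<close> would be
  \<open>z * \<bar>z - a\<bar>\<^sup>2 * Q\<close> up to a constant, and orthogonality to \<open>z * Q\<close> would make the norm of
  \<open>(z - a) * Q\<close> vanish; its degree \<open>N\<close> is too small for that (\<open>no_reflected_root_pair\<close>). So
  \<open>B\<close> has \<open>N + 1\<close> simple roots, all on the circle. Lagrange interpolation at these nodes
  gives a quadrature rule with positive weights that integrates every trigonometric polynomial
  of degree at most \<open>N\<close> exactly (\<open>paraorthogonal_quadrature\<close>).
  
  Evenness of \<open>\<mu>\<close> makes \<open>B\<close> real, so the nodes are symmetric about \<open>0\<close>. The node \<open>0\<close>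
  itself is excluded, since by symmetry it would be a double root, and there are at least two
  nodes. Hence the nodes closest to \<open>0\<close> are \<open>\<theta>\<close> and \<open>- \<theta>\<close> with \<open>0 < \<theta> < 1 / 2\<close>.
  
  If a competitor \<open>f\<close> is non-negative from radius \<open>\<theta>\<close> on, it is non-negative at all nodes,
  while its integral is at most zero; by the quadrature rule it vanishes at every node. It does
  not change sign at a node beyond its last sign change, so such a node is a double root
  (\<open>competitor_factorization\<close>). When the last sign change comes before \<open>\<theta>\<close>, this makes
  \<open>2 * N + 2\<close> roots of \<open>G\<close>, so \<open>f = 0\<close>. When it is exactly \<open>\<theta>\<close>, all nodes but
  \<open>\<theta>\<close> and \<open>- \<theta>\<close> are double roots; these are \<open>2 * N\<close> roots, which determine \<open>f\<close> up to a
  factor. The quotient \<open>extremal_fun\<close> has precisely these roots, vanishes at all nodes, hence has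
  integral zero, and changes sign at \<open>\<theta>\<close>.
  
  When the support has at most \<open>N\<close> points, the squared modulus of the polynomial with roots at
  these points is an admissible function without any sign change (\<open>rho_eq_zero_if_supp_size_le\<close>).
\<close>

section \<open>Reversal of polynomials on the unit circle\<close>

lemma star_poly_on_circle:
  assumes "cmod z = 1"
  shows "poly (star_poly P) z = z ^ degree P * cnj (poly P z)"
proof -
  have unit: "z * cnj z = 1"
    using assms complex_norm_square[of z] by simp
  then have "z \<noteq> 0" by auto
  moreover have "1 / cnj z = z"
    using unit by (metis mult_zero_right nonzero_divide_eq_eq zero_neq_one)
  ultimately show ?thesis by (simp add: poly_star_poly)
qed

lemma coeff_star_poly:
  "coeff (star_poly P) k = (if k \<le> degree P then cnj (coeff P (degree P - k)) else 0)"
proof -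
  have "degree (map_poly cnj P) = degree P" by (rule degree_map_poly) simp
  then show ?thesis by (auto simp: star_poly_def coeff_reflect_poly coeff_map_poly)
qed

lemma degree_star_poly_le: "degree (star_poly P) \<le> degree P"
  by (rule degree_le) (simp add: coeff_star_poly)

lemma unit_power_mult_cnj:
  assumes "cmod z = 1"
  shows "z ^ k * cnj (z ^ k) = 1"
  by (metis assms complex_norm_square norm_power of_real_1 power_one)

lemma star_poly_smult_real: "star_poly (smult (of_real r) P) = smult (of_real r) (star_poly P)"
  by (cases "r = 0") (auto simp: poly_eq_iff coeff_star_poly)

lemma poly_eq_linear_factor_div:
  fixes P :: "'a :: field poly"
  assumes "poly P a = 0"
  shows "P = [:- a, 1:] * (P div [:- a, 1:])"
  using assms by (simp only: poly_eq_0_iff_dvd dvd_mult_div_cancel)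

section \<open>Orthogonal polynomials on the unit circle\<close>

locale circle_supported = finite_measure M for M :: "complex measure" +
  assumes sets_M: "sets M = sets borel"
    and AE_unit: "AE z in M. cmod z = 1"
begin

lemma measurable_continuous [intro]:
  fixes h :: "complex \<Rightarrow> 'b :: topological_space"
  assumes "continuous_on UNIV h"
  shows "h \<in> borel_measurable M"
  using borel_measurable_continuous_onI[OF assms] sets_M measurable_cong_sets by blast

text \<open>
  A continuous function on the plane may be unbounded, but \<open>M\<close> lives on the compact circle.
\<close>

lemma integrable_continuous:
  fixes h :: "complex \<Rightarrow> 'b :: {banach, second_countable_topology}"
  assumes "continuous_on UNIV h"
  shows "integrable M h"
proof -
  have "compact (h ` sphere 0 1)"
    using assms continuous_on_subset by (blast intro: compact_continuous_image compact_sphere)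
  then obtain K where K: "\<And>z. cmod z = 1 \<Longrightarrow> norm (h z) \<le> K"
    using compact_imp_bounded bounded_iff by (metis (no_types, lifting) imageI mem_sphere_0)
  show ?thesis
    using AE_unit K assms by (intro integrable_const_bound[of _ K]) auto
qed

lemma integral_cong_circle:
  fixes f g :: "complex \<Rightarrow> 'b :: {banach, second_countable_topology}"
  assumes "continuous_on UNIV f" "continuous_on UNIV g"
    and "\<And>z. cmod z = 1 \<Longrightarrow> f z = g z"
  shows "(LINT z|M. f z) = (LINT z|M. g z)"
  using assms AE_unit by (intro integral_cong_AE) auto

definition ip :: "complex poly \<Rightarrow> complex poly \<Rightarrow> complex" where
  "ip P Q = (LINT z|M. poly P z * cnj (poly Q z))"

lemma integrable_ip: "integrable M (\<lambda>z. poly P z * cnj (poly Q z))"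
  by (intro integrable_continuous continuous_intros)

lemma ip_add_left: "ip (P + Q) R = ip P R + ip Q R"
  by (simp add: ip_def distrib_right integrable_ip)

lemma ip_diff_left: "ip (P - Q) R = ip P R - ip Q R"
  by (simp add: ip_def left_diff_distrib integrable_ip)

lemma ip_smult_left: "ip (smult c P) R = c * ip P R"
  by (simp add: ip_def mult.assoc)

lemma ip_zero_left [simp]: "ip 0 R = 0"
  by (simp add: ip_def)

lemma ip_sum_left: "ip (\<Sum>i\<in>I. P i) R = (\<Sum>i\<in>I. ip (P i) R)"
  by (induction I rule: infinite_finite_induct) (simp_all add: ip_add_left)

lemma cnj_ip: "cnj (ip P Q) = ip Q P"
proof -
  have "cnj (ip P Q) = (LINT z|M. cnj (poly P z * cnj (poly Q z)))"
    unfolding ip_def by (rule Bochner_Integration.integral_cnj[symmetric])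
  then show ?thesis by (simp add: ip_def mult.commute)
qed

lemma ip_eq_zero_if_orthogonal:
  assumes "\<And>k. coeff Q k \<noteq> 0 \<Longrightarrow> ip P (monom 1 k) = 0"
  shows "ip P Q = 0"
proof -
  have "ip Q P = ip (\<Sum>k\<le>degree Q. smult (coeff Q k) (monom 1 k)) P"
    by (simp add: smult_monom poly_as_sum_of_monoms)
  also have "\<dots> = (\<Sum>k\<le>degree Q. coeff Q k * cnj (ip P (monom 1 k)))"
    by (simp add: ip_sum_left ip_smult_left cnj_ip)
  also have "\<dots> = 0"
    using assms by (intro sum.neutral) auto
  finally show ?thesis by (metis cnj_ip complex_cnj_zero)
qed

text \<open>
  Multiplication by \<open>z\<close> is unitary, as \<open>z * cnj z = 1\<close> almost everywhere.
\<close>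

lemma ip_shift:
  assumes "j \<le> k"
  shows "ip (P * monom 1 j) (monom 1 k) = ip P (monom 1 (k - j))"
  unfolding ip_def
proof (rule integral_cong_circle)
  fix z :: complex
  assume "cmod z = 1"
  then have "z ^ j * cnj (z ^ j) = 1"
    by (metis complex_norm_square mult_1 norm_power of_real_1 power_one)
  moreover have "z ^ k = z ^ (k - j) * z ^ j"
    using assms by (simp flip: power_add)
  ultimately show "poly (P * monom 1 j) z * cnj (poly (monom 1 k) z)
      = poly P z * cnj (poly (monom 1 (k - j)) z)"
    by (simp add: poly_monom mult.assoc mult.left_commute)
qed (auto intro!: continuous_intros)

lemma ip_self: "ip P P = of_real (LINT z|M. (cmod (poly P z))\<^sup>2)"
  unfolding ip_def by (simp only: complex_norm_square[symmetric] integral_complex_of_real)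

text \<open>
  A polynomial of norm zero vanishes almost everywhere, hence by continuity on the whole support, which
  has more points than a nonzero polynomial of that degree has roots.
\<close>

lemma ip_self_eq_zeroD:
  assumes "ip P P = 0" and "enat (degree P) < supp_size M"
  shows "P = 0"
proof (rule ccontr)
  assume "P \<noteq> 0"
  have int: "integrable M (\<lambda>z. (cmod (poly P z))\<^sup>2)"
    by (intro integrable_continuous continuous_intros)
  have "(LINT z|M. (cmod (poly P z))\<^sup>2) = 0"
    using assms(1) by (simp add: ip_self)
  then have ae: "AE z in M. poly P z = 0"
    using integral_nonneg_eq_0_iff_AE[OF int] by simp
  have sub: "msupp M \<subseteq> {z. poly P z = 0}"
  proof (rule ccontr)
    assume "\<not> ?thesis"
    then obtain z where z: "z \<in> msupp M" "poly P z \<noteq> 0" by auto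
    have op: "open {w. poly P w \<noteq> 0}"
      by (intro open_Collect_neq continuous_intros)
    then have "emeasure M {w. poly P w \<noteq> 0} > 0"
      using z unfolding msupp_def by simp
    moreover have "emeasure M {w. poly P w \<noteq> 0} = 0"
      using ae op sets_M
      by (subst (asm) AE_iff_measurable[OF _ refl])
        (auto simp: sets_eq_imp_space_eq[OF sets_M])
    ultimately show False by simp
  qed
  have fin: "finite {z. poly P z = 0}" by (rule poly_roots_finite) fact
  have "card (msupp M) \<le> degree P"
    using card_mono[OF fin sub] card_poly_roots_bound[OF \<open>P \<noteq> 0\<close>] by linarith
  moreover have "finite (msupp M)" using sub fin by (rule finite_subset)
  ultimately show False using assms(2) by (simp add: supp_size_def)
qed

text \<open>
  Gram-Schmidt in the monomials. To make \<open>P - Q\<close> orthogonal to \<open>z ^ n\<close> as well, subtract a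
  multiple of \<open>T\<close>, which is \<open>z ^ n\<close> minus its own projection; the right multiple exists because
  \<open>\<langle>T, z ^ n\<rangle> = \<langle>T, T\<rangle> \<noteq> 0\<close>.
\<close>

lemma ex_orthogonal_projection:
  assumes "enat n \<le> supp_size M"
  shows "\<exists>Q. (\<forall>k\<ge>n. coeff Q k = 0) \<and> (\<forall>k<n. ip (P - Q) (monom 1 k) = 0)"
  using assms
proof (induction n arbitrary: P)
  case 0
  show ?case by (intro exI[of _ 0]) simp
next
  case (Suc n)
  have n: "enat n < supp_size M" using Suc.prems by (simp add: Suc_ile_eq)
  obtain Q where Q: "\<And>k. k \<ge> n \<Longrightarrow> coeff Q k = 0" "\<And>k. k < n \<Longrightarrow> ip (P - Q) (monom 1 k) = 0"
    using Suc.IH[of P] n by (auto simp: less_imp_le)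
  obtain R where R: "\<And>k. k \<ge> n \<Longrightarrow> coeff R k = 0"
      "\<And>k. k < n \<Longrightarrow> ip (monom 1 n - R) (monom 1 k) = 0"
    using Suc.IH[of "monom 1 n"] n by (auto simp: less_imp_le)
  define T where "T = monom 1 n - R"
  have T: "coeff T n = 1" "\<And>k. k > n \<Longrightarrow> coeff T k = 0" "\<And>k. k < n \<Longrightarrow> ip T (monom 1 k) = 0"
    using R by (auto simp: T_def)
  have "ip T (monom 1 n) \<noteq> 0"
  proof
    assume "ip T (monom 1 n) = 0"
    have "ip T T = 0"
    proof (rule ip_eq_zero_if_orthogonal)
      fix k assume "coeff T k \<noteq> 0"
      then have "k \<le> n" using T(2)[of k] by (cases "n < k") auto
      then show "ip T (monom 1 k) = 0"
        using T(3) \<open>ip T (monom 1 n) = 0\<close> by (cases "k = n") auto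
    qed
    moreover have "degree T = n"
      using T(1,2) by (intro antisym degree_le le_degree) auto
    ultimately have "T = 0" using n ip_self_eq_zeroD by simp
    then show False using T by simp
  qed
  define c where "c = ip (P - Q) (monom 1 n) / ip T (monom 1 n)"
  have "ip (P - (Q + smult c T)) (monom 1 k) = 0" if "k < Suc n" for k
  proof -
    have "ip (P - (Q + smult c T)) (monom 1 k) = ip (P - Q) (monom 1 k) - c * ip T (monom 1 k)"
      by (simp only: diff_diff_eq[symmetric] ip_diff_left[of "P - Q"] ip_smult_left)
    then show ?thesis
      using that Q(2)[of k] T(3)[of k] \<open>ip T (monom 1 n) \<noteq> 0\<close>
      by (cases "k = n") (auto simp: c_def)
  qed
  moreover have "\<forall>k\<ge>Suc n. coeff (Q + smult c T) k = 0"
    using Q(1) T(2) by simp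
  ultimately show ?case by blast
qed

definition is_monic_OP :: "nat \<Rightarrow> complex poly \<Rightarrow> bool" where
  "is_monic_OP n P \<longleftrightarrow> degree P = n \<and> lead_coeff P = 1 \<and> (\<forall>k<n. ip P (monom 1 k) = 0)"

lemma is_monic_OP_unique:
  assumes "enat n < supp_size M" and "is_monic_OP n P" and "is_monic_OP n Q"
  shows "P = Q"
proof -
  have P: "degree P = n" "coeff P n = 1" "\<And>k. k < n \<Longrightarrow> ip P (monom 1 k) = 0"
    and Q: "degree Q = n" "coeff Q n = 1" "\<And>k. k < n \<Longrightarrow> ip Q (monom 1 k) = 0"
    using assms by (auto simp: is_monic_OP_def)
  have c: "coeff (P - Q) k = 0" if "k \<ge> n" for k
    using that P Q by (cases "k = n") (auto simp: coeff_eq_0)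
  have "ip (P - Q) (P - Q) = 0"
  proof (rule ip_eq_zero_if_orthogonal)
    fix k assume "coeff (P - Q) k \<noteq> 0"
    then have "k < n" using c[of k] by (cases "k < n") auto
    then show "ip (P - Q) (monom 1 k) = 0" using P(3) Q(3) by (simp add: ip_diff_left)
  qed
  moreover have "degree (P - Q) \<le> n" using c by (intro degree_le) auto
  ultimately have "P - Q = 0"
    using assms(1) by (intro ip_self_eq_zeroD) (auto intro: le_less_trans[of _ "enat n"])
  then show ?thesis by simp
qed

lemma is_monic_OP_monic_OP:
  assumes "enat n < supp_size M"
  shows "is_monic_OP n (monic_OP M n)"
proof -
  obtain R where R: "\<And>k. k \<ge> n \<Longrightarrow> coeff R k = 0"
      "\<And>k. k < n \<Longrightarrow> ip (monom 1 n - R) (monom 1 k) = 0"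
    using ex_orthogonal_projection[of n "monom 1 n"] assms by (auto simp: less_imp_le)
  have c: "coeff (monom 1 n - R) n = 1" "\<And>k. k > n \<Longrightarrow> coeff (monom 1 n - R) k = 0"
    using R(1) by auto
  then have "degree (monom 1 n - R) = n"
    by (intro antisym degree_le le_degree) (auto simp del: coeff_diff)
  then have ex: "is_monic_OP n (monom 1 n - R)"
    using R c by (simp add: is_monic_OP_def)
  have "monic_OP M n = (THE P. is_monic_OP n P)"
    by (simp add: monic_OP_def is_monic_OP_def ip_def poly_monom)
  then show ?thesis
    using ex is_monic_OP_unique[OF assms] by (metis theI)
qed

text \<open>
  The reversal of an orthogonal polynomial is orthogonal to the reversed range of powers:
  on the circle it is \<open>z ^ degree P * cnj P\<close>.
\<close>

lemma ip_star_poly: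
  assumes "k \<le> degree P"
  shows "ip (star_poly P) (monom 1 k) = cnj (ip P (monom 1 (degree P - k)))"
  unfolding cnj_ip unfolding ip_def
proof (rule integral_cong_circle)
  fix z :: complex
  assume z: "cmod z = 1"
  have "z ^ degree P = z ^ (degree P - k) * z ^ k"
    using assms by (simp flip: power_add)
  then show "poly (star_poly P) z * cnj (poly (monom 1 k) z)
      = poly (monom 1 (degree P - k)) z * cnj (poly P z)"
    using unit_power_mult_cnj[OF z, of k]
    by (simp add: poly_monom star_poly_on_circle[OF z] mult.assoc mult.left_commute)
qed (auto intro!: continuous_intros)

section \<open>Para-orthogonal polynomials and their quadrature rule\<close>

text \<open>
  These are the para-orthogonal polynomials of Jones, Njastad and Thron, normalized so that the
  reversal fixes them. The missing orthogonality to \<open>1\<close> and \<open>z ^ n\<close> is the price for having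
  all roots on the circle.
\<close>

definition paraorthogonal :: "nat \<Rightarrow> complex poly \<Rightarrow> bool" where
  "paraorthogonal n B \<longleftrightarrow>
     degree B = n \<and> star_poly B = B \<and> (\<forall>k\<in>{1..<n}. ip B (monom 1 k) = 0)"

lemma paraorthogonal_smult:
  assumes "paraorthogonal n B" and "r \<noteq> 0"
  shows "paraorthogonal n (smult (of_real r) B)"
  using assms by (simp add: paraorthogonal_def star_poly_smult_real ip_smult_left)

text \<open>
  Orthogonality and symmetry are inherited from the summands; the delicate point is that the
  leading terms do not cancel. If they did, the sum would have neither a constant nor a leading
  term and would be orthogonal to itself, hence zero. Then the monic orthogonal polynomial would
  be minus its reversal, so orthogonal to \<open>z ^ n\<close> too, and would be zero as well.
\<close>

lemma paraorthogonal_monic_OP_plus_star: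
  assumes supp: "enat n < supp_size M" and "1 \<le> n" and "is_monic_OP n P"
  shows "paraorthogonal n (P + star_poly P)"
proof -
  have P: "degree P = n" "coeff P n = 1" "\<And>k. k < n \<Longrightarrow> ip P (monom 1 k) = 0"
    using assms by (auto simp: is_monic_OP_def)
  let ?D = "P + star_poly P"
  have le: "degree ?D \<le> n"
    using degree_add_le[of P n "star_poly P"] degree_star_poly_le[of P] P by simp
  have orth: "ip ?D (monom 1 k) = 0" if "k \<in> {1..<n}" for k
    using that P by (simp add: ip_add_left ip_star_poly)
  have "coeff ?D n \<noteq> 0"
  proof
    assume top: "coeff ?D n = 0"
    then have "1 + cnj (coeff P 0) = 0"
      using P by (simp add: coeff_star_poly)
    then have "coeff P 0 = - 1"
      by (metis add_eq_0_iff complex_cnj_cnj complex_cnj_minus complex_cnj_one)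
    then have bot: "coeff ?D 0 = 0"
      using P by (simp add: coeff_star_poly)
    have "ip ?D ?D = 0"
    proof (rule ip_eq_zero_if_orthogonal)
      fix k assume k: "coeff ?D k \<noteq> 0"
      then have "k \<noteq> 0" "k \<noteq> n" using top bot by (metis, metis)
      moreover have "k \<le> n" using le le_degree[OF k] by linarith
      ultimately show "ip ?D (monom 1 k) = 0" using orth by simp
    qed
    then have "?D = 0"
      by (rule ip_self_eq_zeroD) (rule le_less_trans[OF _ supp], simp add: le)
    then have "P = smult (- 1) (star_poly P)" by (simp add: add_eq_0_iff2)
    then have "ip P (monom 1 n) = - 1 * ip (star_poly P) (monom 1 n)"
      by (metis ip_smult_left)
    also have "\<dots> = 0" using P P(3)[of 0] \<open>1 \<le> n\<close> by (simp add: ip_star_poly)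
    finally have "ip P (monom 1 n) = 0" .
    then have "ip P (monom 1 k) = 0" if "coeff P k \<noteq> 0" for k
      using P(3)[of k] P(1) le_degree[OF that] by (cases "k = n") auto
    then have "ip P P = 0" by (rule ip_eq_zero_if_orthogonal)
    then have "P = 0" using P supp ip_self_eq_zeroD by simp
    then show False using P by simp
  qed
  then have deg: "degree ?D = n" using le le_degree by (metis le_antisym)
  have "star_poly ?D = ?D"
    using P deg by (simp add: poly_eq_iff coeff_star_poly coeff_eq_0)
  then show ?thesis using deg orth by (simp add: paraorthogonal_def)
qed

text \<open>
  This variant only involves the orthogonal polynomial of degree \<open>n\<close>, so it still produces
  a para-orthogonal polynomial of degree \<open>Suc n\<close> when the support has exactly \<open>Suc n\<close> points.
\<close>

lemma paraorthogonal_shift_monic_OP_plus_star: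
  assumes "is_monic_OP n P"
  shows "paraorthogonal (Suc n) (pCons 0 P + star_poly P)"
proof -
  have P: "degree P = n" "coeff P n = 1" "\<And>k. k < n \<Longrightarrow> ip P (monom 1 k) = 0"
    using assms by (auto simp: is_monic_OP_def)
  let ?D = "pCons 0 P + star_poly P"
  have "degree (star_poly P) < degree (pCons 0 P)"
    using degree_star_poly_le[of P] P by (auto simp: degree_pCons_eq_if)
  then have deg: "degree ?D = Suc n"
    using P by (auto simp: degree_add_eq_left degree_pCons_eq_if)
  have "ip ?D (monom 1 k) = 0" if "k \<in> {1..<Suc n}" for k
  proof -
    have "ip (pCons 0 P) (monom 1 k) = ip P (monom 1 (k - 1))"
      using ip_shift[of 1 k P] that by (simp add: monom_altdef)
    moreover have "k - 1 < n" "n - k < n" "k \<le> n" using that by auto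
    ultimately show ?thesis
      using P by (simp add: ip_add_left ip_star_poly)
  qed
  moreover have "star_poly ?D = ?D"
  proof (rule poly_eqI)
    fix k
    have "m = a - Suc b" if "a - b = Suc m" for a b m :: nat using that by simp
    then show "coeff (star_poly ?D) k = coeff ?D k"
      unfolding coeff_star_poly[of ?D] deg using P
      by (cases k) (auto simp: coeff_star_poly coeff_pCons coeff_eq_0 Suc_diff_le split: nat.split)
  qed
  ultimately show ?thesis using deg by (simp add: paraorthogonal_def)
qed

text \<open>
  On the circle \<open>(z - a) * (z - 1 / cnj a)\<close> is \<open>- z * \<bar>z - a\<bar>\<^sup>2 / cnj a\<close>. Hence
  \<open>T = (z - a) * Q\<close> satisfies \<open>\<langle>T, T\<rangle> = - cnj a * \<langle>B, z * Q\<rangle>\<close>, and the right side vanishes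
  because \<open>z * Q\<close> only involves the powers \<open>z, \<dots>, z ^ (n - 1)\<close>.
\<close>

lemma no_reflected_root_pair:
  assumes para: "paraorthogonal n B" and "1 \<le> n" and supp: "enat n \<le> supp_size M"
    and "a \<noteq> 0" and B: "B = [:- a, 1:] * ([:- (1 / cnj a), 1:] * Q)"
  shows False
proof -
  have "B \<noteq> 0" using para \<open>1 \<le> n\<close> by (auto simp: paraorthogonal_def)
  then have "Q \<noteq> 0" using B by auto
  then have "degree B = Suc (Suc (degree Q))"
    unfolding B by (simp add: degree_mult_eq del: mult_pCons_left mult_pCons_right)
  then have n: "n = Suc (Suc (degree Q))" using para by (simp add: paraorthogonal_def)
  define T where "T = [:- a, 1:] * Q"
  have T: "degree T = Suc (degree Q)"
    unfolding T_def using \<open>Q \<noteq> 0\<close>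
    by (simp add: degree_mult_eq del: mult_pCons_left mult_pCons_right)
  have "ip T T = - cnj a * ip B (pCons 0 Q)"
  proof -
    have "ip T T = ip (smult (- cnj a) B) (pCons 0 Q)"
      unfolding ip_def
    proof (rule integral_cong_circle)
      fix z :: complex
      assume "cmod z = 1"
      then have "z * cnj z = 1" using unit_power_mult_cnj[of z 1] by simp
      then have "- cnj a * (z - 1 / cnj a) * cnj z = cnj (z - a)"
        using \<open>a \<noteq> 0\<close> by (simp add: field_simps)
      then have "cnj (z - a) * ((z - a) * poly Q z * cnj (poly Q z))
          = - cnj a * ((z - a) * ((z - 1 / cnj a) * poly Q z)) * (cnj z * cnj (poly Q z))"
        by (metis (no_types, lifting) mult.assoc mult.commute)
      moreover have "poly [:- c, 1:] z = z - c" for c by simp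
      ultimately show "poly T z * cnj (poly T z)
          = poly (smult (- cnj a) B) z * cnj (poly (pCons 0 Q) z)"
        unfolding B T_def poly_mult poly_smult poly_pCons[of 0 Q] complex_cnj_mult
        by (simp only: mult_ac add_0 complex_cnj_mult)
    qed (intro continuous_intros)+
    then show ?thesis by (simp only: ip_smult_left)
  qed
  also have "ip B (pCons 0 Q) = 0"
  proof (rule ip_eq_zero_if_orthogonal)
    fix k assume k: "coeff (pCons 0 Q) k \<noteq> 0"
    then have "1 \<le> k" by (cases k) auto
    moreover have "k \<le> Suc (degree Q)"
      using le_degree[OF k] by (simp add: degree_pCons_eq_if split: if_splits)
    ultimately show "ip B (monom 1 k) = 0"
      using para n by (simp add: paraorthogonal_def)
  qed
  finally have "T = 0"
    using supp T n by (intro ip_self_eq_zeroD) (simp_all add: Suc_ile_eq)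
  then show False using T by simp
qed

text \<open>
  Being its own reversal, \<open>B\<close> vanishes at \<open>1 / cnj a\<close> whenever it vanishes at \<open>a\<close>. For a root
  off the circle this is a second root, and a double root on the circle is its own mirror
  image; both are excluded by the previous lemma.
\<close>

lemma paraorthogonal_roots:
  assumes para: "paraorthogonal n B" and n: "1 \<le> n" and supp: "enat n \<le> supp_size M"
  shows "poly B a = 0 \<Longrightarrow> cmod a = 1"
    and "rsquarefree B"
    and "card {z. poly B z = 0} = n"
proof -
  have deg: "degree B = n" and star: "star_poly B = B"
    using para by (auto simp: paraorthogonal_def)
  have "B \<noteq> 0" using deg n by auto
  have "coeff B 0 = cnj (lead_coeff B)"
    using arg_cong[OF star, of "\<lambda>p. coeff p 0"] by (simp add: coeff_star_poly)
  then have nz: "a \<noteq> 0" if "poly B a = 0" for a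
    using that \<open>B \<noteq> 0\<close> by (auto simp: poly_0_coeff_0)
  show *: "cmod a = 1" if a: "poly B a = 0" for a
  proof (rule ccontr)
    assume "cmod a \<noteq> 1"
    define b where "b = 1 / cnj a"
    have "b \<noteq> a"
    proof
      assume "b = a"
      then have "a * cnj a = 1" using nz[OF a] by (simp add: b_def field_simps)
      then have "(cmod a)\<^sup>2 = 1" by (metis complex_norm_square of_real_eq_1_iff)
      then show False using \<open>cmod a \<noteq> 1\<close> by (simp add: power2_eq_1_iff) (smt (verit) norm_ge_zero)
    qed
    have "poly B b = 0"
      using poly_star_poly[of b B] star a nz[OF a] by (simp add: b_def)
    define R where "R = B div [:- a, 1:]"
    have R: "B = [:- a, 1:] * R"
      unfolding R_def using a by (rule poly_eq_linear_factor_div)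
    have "poly B b = (b - a) * poly R b" by (subst R) (simp add: algebra_simps)
    then have "poly R b = 0" using \<open>poly B b = 0\<close> \<open>b \<noteq> a\<close> by simp
    then have "R = [:- b, 1:] * (R div [:- b, 1:])" by (rule poly_eq_linear_factor_div)
    then show False
      using no_reflected_root_pair[OF para n supp nz[OF a]] R unfolding b_def by metis
  qed
  show sqf: "rsquarefree B"
    unfolding rsquarefree_roots
  proof (intro allI notI, elim conjE)
    fix a assume a: "poly B a = 0" "poly (pderiv B) a = 0"
    define R where "R = B div [:- a, 1:]"
    have R: "B = [:- a, 1:] * R"
      unfolding R_def using a(1) by (rule poly_eq_linear_factor_div)
    have "poly (pderiv B) a = poly R a"
      by (subst R) (simp add: pderiv_mult pderiv_pCons del: mult_pCons_left mult_pCons_right)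
    then have "R = [:- a, 1:] * (R div [:- a, 1:])"
      using a(2) by (intro poly_eq_linear_factor_div) simp
    moreover have "a = 1 / cnj a"
      using unit_power_mult_cnj[OF *[OF a(1)], of 1] nz[OF a(1)] by (simp add: field_simps)
    ultimately show False
      using no_reflected_root_pair[OF para n supp nz[OF a(1)]] R by metis
  qed
  have "degree B = degree (\<Prod>z | poly B z = 0. [:- z, 1:])"
    using complex_poly_decompose_rsquarefree[OF sqf] \<open>B \<noteq> 0\<close>
    by (metis degree_smult_eq leading_coeff_0_iff)
  also have "\<dots> = card {z. poly B z = 0}"
    by (subst degree_prod_eq_sum_degree) auto
  finally show "card {z. poly B z = 0} = n" using deg by simp
qed

text \<open>
  A real self-reversed \<open>B\<close> satisfies \<open>B z = z ^ n * B (1 / z)\<close>. The factor \<open>z - 1\<close> is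
  antisymmetric under this reversal, so after splitting it off the cofactor is antisymmetric and
  vanishes at \<open>1\<close> again: the root would be double.
\<close>

lemma paraorthogonal_one_not_root:
  assumes para: "paraorthogonal n B" and n: "1 \<le> n" and supp: "enat n \<le> supp_size M"
    and real: "map_poly cnj B = B"
  shows "poly B 1 \<noteq> 0"
proof
  assume "poly B 1 = 0"
  define R where "R = B div [:- 1, 1:]"
  have R: "B = [:- 1, 1:] * R"
    unfolding R_def using \<open>poly B 1 = 0\<close> by (rule poly_eq_linear_factor_div)
  have "[:- 1, 1:] * R = reflect_poly ([:- 1, 1:] * R)"
    using para real by (simp only: R[symmetric] paraorthogonal_def star_poly_def)
  also have "\<dots> = [:- 1, 1:] * (- reflect_poly R)"
  proof -
    have "reflect_poly [:- 1, 1 :: complex:] = - [:- 1, 1:]"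
      by (simp add: reflect_poly_pCons)
    then show ?thesis by (simp only: reflect_poly_mult mult_minus_left mult_minus_right)
  qed
  finally have "R = - reflect_poly R"
    by (metis mult_cancel_left one_neq_zero pCons_eq_0_iff)
  then have "poly R 1 = - poly (reflect_poly R) 1"
    by (metis poly_minus)
  also have "poly (reflect_poly R) 1 = poly R 1"
    by (simp add: poly_reflect_poly_nz)
  finally have "poly R 1 = 0" by simp
  then have "poly (pderiv B) 1 = 0"
    by (subst R) (simp add: pderiv_mult pderiv_pCons del: mult_pCons_left mult_pCons_right)
  then show False
    using \<open>poly B 1 = 0\<close> paraorthogonal_roots(2)[OF para n supp] rsquarefree_roots by metis
qed

text \<open>
  The analogue of Gauss quadrature. Here \<open>ip G (monom 1 N)\<close> is the integral of the
  trigonometric polynomial \<open>G z / z ^ N\<close>. Dividing \<open>G = Q * B + R\<close>, the part \<open>Q * B\<close> integrates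
  to zero by para-orthogonality, and \<open>R\<close> is given by Lagrange interpolation at the roots of
  \<open>B\<close>. Applying the resulting rule to \<open>\<bar>L a\<bar>\<^sup>2\<close>, where \<open>L a\<close> is the Lagrange polynomial of
  the node \<open>a\<close>, shows that the weight of \<open>a\<close> is the integral of \<open>\<bar>L a\<bar>\<^sup>2\<close> divided by its
  value at \<open>a\<close>.
\<close>

lemma paraorthogonal_quadrature:
  assumes para: "paraorthogonal (Suc N) B" and supp: "enat N < supp_size M"
  shows "\<exists>w :: complex \<Rightarrow> real. (\<forall>a. poly B a = 0 \<longrightarrow> w a > 0) \<and>
    (\<forall>G. degree G \<le> 2 * N \<longrightarrow>
      ip G (monom 1 N) = (\<Sum>a | poly B a = 0. of_real (w a) * (poly G a * cnj a ^ N)))"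
proof -
  have supp': "enat (Suc N) \<le> supp_size M" using supp by (simp add: Suc_ile_eq)
  note roots = paraorthogonal_roots[OF para _ supp', simplified]
  have deg: "degree B = Suc N" and "B \<noteq> 0"
    and orth: "\<And>k. k \<in> {1..N} \<Longrightarrow> ip B (monom 1 k) = 0"
    using para by (auto simp: paraorthogonal_def)
  let ?Z = "{a. poly B a = 0}"
  have fin: "finite ?Z" using \<open>B \<noteq> 0\<close> by (rule poly_roots_finite)
  define L where "L a = B div [:- a, 1:]" for a
  have L: "B = [:- a, 1:] * L a" if "poly B a = 0" for a
    unfolding L_def using that by (rule poly_eq_linear_factor_div)
  have L_deg: "degree (L a) = N" if "poly B a = 0" for a
  proof -
    have "L a \<noteq> 0" using L[OF that] \<open>B \<noteq> 0\<close> by auto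
    then have "degree B = Suc (degree (L a))"
      by (subst L[OF that]) (simp add: degree_mult_eq del: mult_pCons_left mult_pCons_right)
    then show ?thesis using deg by simp
  qed
  have L_other: "poly (L a) b = 0" if "poly B a = 0" "poly B b = 0" "b \<noteq> a" for a b
  proof -
    have "poly B b = (b - a) * poly (L a) b" by (subst L[OF that(1)]) (simp add: algebra_simps)
    then show ?thesis using that by simp
  qed
  have L_self: "poly (L a) a \<noteq> 0" if "poly B a = 0" for a
  proof -
    have "poly (pderiv B) a = poly (L a) a"
      by (subst L[OF that]) (simp add: pderiv_mult pderiv_pCons del: mult_pCons_left mult_pCons_right)
    then show ?thesis using that roots(2) rsquarefree_roots by metis
  qed
  have exact: "ip G (monom 1 N)
      = (\<Sum>a\<in>?Z. poly G a / poly (L a) a * ip (L a) (monom 1 N))"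
    if G: "degree G \<le> 2 * N" for G
  proof -
    define Q R where "Q = G div B" and "R = G mod B"
    have GQR: "G = Q * B + R" by (simp add: Q_def R_def)
    have R_deg: "degree R \<le> N"
      using degree_mod_less[OF \<open>B \<noteq> 0\<close>, of G] deg by (auto simp: R_def)
    have Q_coeff: "k < N" if k: "coeff Q k \<noteq> 0" for k
    proof -
      have "Q \<noteq> 0" using k by auto
      then have "degree (Q * B) = degree Q + Suc N"
        using \<open>B \<noteq> 0\<close> deg by (simp add: degree_mult_eq)
      moreover have "Q * B = G - R" using GQR by simp
      then have "degree (Q * B) \<le> 2 * N"
        using degree_diff_le[OF G, of R] R_deg by simp
      ultimately show ?thesis using le_degree[OF k] by linarith
    qed
    have "ip (Q * B) (monom 1 N) = 0"
    proof -
      have "Q * B = (\<Sum>j\<le>degree Q. smult (coeff Q j) (B * monom 1 j))"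
        by (subst (1) poly_as_sum_of_monoms[symmetric])
          (simp add: sum_distrib_right sum_distrib_left smult_monom mult.commute
            flip: mult_smult_right)
      moreover have "coeff Q j * ip (B * monom 1 j) (monom 1 N) = 0" for j
        using Q_coeff[of j] ip_shift[of j N B] orth[of "N - j"]
        by (cases "coeff Q j = 0") auto
      ultimately show ?thesis by (simp only: ip_sum_left ip_smult_left sum.neutral_const)
    qed
    then have "ip G (monom 1 N) = ip R (monom 1 N)"
      by (subst GQR) (simp add: ip_add_left)
    also have "R = (\<Sum>a\<in>?Z. smult (poly R a / poly (L a) a) (L a))" (is "_ = ?S")
    proof (rule poly_eqI_degree[where A = ?Z])
      fix b assume b: "b \<in> ?Z"
      have "poly ?S b = (\<Sum>a\<in>?Z. if a = b then poly R b else 0)"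
        unfolding poly_sum using b L_other L_self by (intro sum.cong) auto
      then show "poly R b = poly ?S b" using b fin by simp
    next
      show "degree R < card ?Z" using R_deg roots(3) by simp
      have "degree ?S \<le> N"
        using fin L_deg by (intro degree_sum_le) (auto intro: order_trans[OF degree_smult_le])
      then show "degree ?S < card ?Z" using roots(3) by simp
    qed
    also have "ip ?S (monom 1 N) = (\<Sum>a\<in>?Z. poly R a / poly (L a) a * ip (L a) (monom 1 N))"
      by (simp add: ip_sum_left ip_smult_left)
    also have "\<dots> = (\<Sum>a\<in>?Z. poly G a / poly (L a) a * ip (L a) (monom 1 N))"
      by (intro sum.cong) (auto simp: GQR)
    finally show ?thesis .
  qed
  define w where "w a = (LINT z|M. (cmod (poly (L a) z))\<^sup>2) / (cmod (poly (L a) a))\<^sup>2" for a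
  have weight: "ip (L a) (monom 1 N) / poly (L a) a = of_real (w a) * cnj a ^ N"
    if a: "poly B a = 0" for a
  proof -
    \<comment> \<open>on the circle, \<open>?H z = z ^ N * \<bar>L a z\<bar>\<^sup>2\<close>\<close>
    let ?H = "L a * star_poly (L a)"
    have "degree ?H \<le> 2 * N"
      using degree_mult_le[of "L a" "star_poly (L a)"] degree_star_poly_le[of "L a"] L_deg[OF a]
      by linarith
    then have "ip ?H (monom 1 N)
        = (\<Sum>b\<in>?Z. poly ?H b / poly (L b) b * ip (L b) (monom 1 N))"
      by (rule exact)
    also have "\<dots> = (\<Sum>b\<in>?Z. if b = a then poly (star_poly (L a)) a * ip (L a) (monom 1 N) else 0)"
      using a L_other L_self by (intro sum.cong) auto
    also have "\<dots> = a ^ N * cnj (poly (L a) a) * ip (L a) (monom 1 N)"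
      using a fin star_poly_on_circle[OF roots(1)[OF a]] L_deg[OF a] by simp
    also have "ip ?H (monom 1 N) = ip (L a) (L a)"
      unfolding ip_def
    proof (rule integral_cong_circle)
      fix z :: complex
      assume z: "cmod z = 1"
      show "poly ?H z * cnj (poly (monom 1 N) z) = poly (L a) z * cnj (poly (L a) z)"
        using unit_power_mult_cnj[OF z, of N] L_deg[OF a]
        by (simp add: star_poly_on_circle[OF z] poly_monom mult.assoc mult.left_commute)
    qed (intro continuous_intros)+
    finally have eq: "a ^ N * cnj (poly (L a) a) * ip (L a) (monom 1 N) = ip (L a) (L a)" by simp
    have "ip (L a) (monom 1 N) / poly (L a) a
        = (cnj a ^ N * a ^ N) * ip (L a) (monom 1 N) / poly (L a) a"
      using unit_power_mult_cnj[OF roots(1)[OF a], of N] by (simp add: mult.commute)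
    also have "\<dots> = cnj a ^ N * ip (L a) (L a) / (poly (L a) a * cnj (poly (L a) a))"
      using L_self[OF a] by (simp flip: eq)
    finally show ?thesis
      by (simp add: w_def ip_self complex_norm_square mult.commute flip: of_real_power)
  qed
  show ?thesis
  proof (intro exI conjI allI impI)
    fix a assume a: "poly B a = 0"
    have "ip (L a) (L a) \<noteq> 0"
      using ip_self_eq_zeroD[of "L a"] L_deg[OF a] supp L_self[OF a] by auto
    moreover have "(LINT z|M. (cmod (poly (L a) z))\<^sup>2) \<ge> 0"
      by (intro integral_nonneg_AE) simp
    ultimately have "(LINT z|M. (cmod (poly (L a) z))\<^sup>2) > 0"
      by (simp add: ip_self order_less_le)
    then show "w a > 0"
      using L_self[OF a] by (simp add: w_def)
  next
    fix G :: "complex poly"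
    assume "degree G \<le> 2 * N"
    have "poly G a / poly (L a) a * ip (L a) (monom 1 N) = of_real (w a) * (poly G a * cnj a ^ N)"
      if "a \<in> ?Z" for a
      using weight[of a] that by (simp add: divide_simps mult_ac split: if_splits)
    then show "ip G (monom 1 N) = (\<Sum>a\<in>?Z. of_real (w a) * (poly G a * cnj a ^ N))"
      using exact[OF \<open>degree G \<le> 2 * N\<close>] by simp
  qed
qed

end

section \<open>Measures invariant under complex conjugation\<close>

locale symmetric_circle_supported = circle_supported +
  assumes distr_cnj: "distr M borel cnj = M"
begin

lemma ip_map_poly_cnj: "ip (map_poly cnj P) (map_poly cnj Q) = cnj (ip P Q)"
proof -
  let ?h = "\<lambda>z. poly Q z * cnj (poly P z)"
  have "?h \<in> borel_measurable borel"
    by (intro borel_measurable_continuous_onI continuous_intros)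
  moreover have "cnj \<in> measurable M borel"
    by (intro measurable_continuous continuous_intros)
  ultimately have "(LINT z|distr M borel cnj. ?h z) = (LINT z|M. ?h (cnj z))"
    by (intro integral_distr)
  then show ?thesis
    unfolding cnj_ip by (simp add: distr_cnj ip_def mult.commute)
qed

text \<open>
  Conjugating the coefficients preserves the defining conditions, so uniqueness forces the
  coefficients to be real.
\<close>

lemma map_poly_cnj_monic_OP:
  assumes "enat n < supp_size M"
  shows "map_poly cnj (monic_OP M n) = monic_OP M n"
proof (rule is_monic_OP_unique[OF assms])
  show *: "is_monic_OP n (monic_OP M n)" by (rule is_monic_OP_monic_OP[OF assms])
  have deg: "degree (map_poly cnj P) = degree P" for P by (rule degree_map_poly) simp
  have "map_poly cnj (monom 1 k) = (monom 1 k :: complex poly)" for k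
    by (simp add: map_poly_monom)
  then have "ip (map_poly cnj P) (monom 1 k) = cnj (ip P (monom 1 k))" for P k
    by (metis ip_map_poly_cnj)
  then show "is_monic_OP n (map_poly cnj (monic_OP M n))"
    using * by (auto simp: is_monic_OP_def deg coeff_map_poly)
qed

text \<open>
  Both branches of the definition of \<open>A_poly_prob\<close> are nonzero real multiples of one of the two
  para-orthogonal polynomials above. The factor comes from normalizing the monic orthogonal
  polynomial, and being real it commutes with the reversal.
\<close>

lemma A_poly_prob_multiple:
  assumes "enat N < supp_size M"
  obtains r P where "r \<noteq> 0" "A_poly_prob M (Suc N) = smult (of_real r) P"
    "paraorthogonal (Suc N) P" "map_poly cnj P = P"
proof -
  have OP: "orthonormal_OP M n = smult (of_real (1 / L2_norm_poly M (monic_OP M n))) (monic_OP M n)"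
    and pos: "L2_norm_poly M (monic_OP M n) \<noteq> 0"
    if "enat n < supp_size M" for n
  proof -
    have "is_monic_OP n (monic_OP M n)" by (rule is_monic_OP_monic_OP[OF that])
    then have "ip (monic_OP M n) (monic_OP M n) \<noteq> 0"
      using that ip_self_eq_zeroD[of "monic_OP M n"] by (auto simp: is_monic_OP_def)
    then show "L2_norm_poly M (monic_OP M n) \<noteq> 0" by (simp add: L2_norm_poly_def ip_self)
  qed (simp add: orthonormal_OP_def)
  have real: "map_poly cnj (P + Q) = P + Q"
    if "map_poly cnj P = P" "map_poly cnj Q = Q" for P Q
    using that by (simp add: poly_eq_iff coeff_map_poly)
  have real_star: "map_poly cnj (star_poly P) = star_poly P" if "map_poly cnj P = P" for P
    using that by (simp add: poly_eq_iff coeff_map_poly coeff_star_poly)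
  have real_pCons: "map_poly cnj (pCons 0 P) = pCons 0 P" if "map_poly cnj P = P" for P
    using that by (simp add: poly_eq_iff coeff_map_poly coeff_pCons split: nat.split)
  show thesis
  proof (cases "enat (Suc N) < supp_size M")
    case True
    let ?P = "monic_OP M (Suc N)"
    show thesis
    proof (rule that)
      show "A_poly_prob M (Suc N)
          = smult (of_real (1 / L2_norm_poly M ?P / 2)) (?P + star_poly ?P)"
        using True unfolding A_poly_prob_def OP[OF True] star_poly_smult_real
        by (simp add: smult_add_right mult.commute)
      show "paraorthogonal (Suc N) (?P + star_poly ?P)"
        using True by (intro paraorthogonal_monic_OP_plus_star is_monic_OP_monic_OP) auto
      show "map_poly cnj (?P + star_poly ?P) = ?P + star_poly ?P"
        using True by (intro real real_star map_poly_cnj_monic_OP)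
      show "1 / L2_norm_poly M ?P / 2 \<noteq> 0" using pos[OF True] by simp
    qed
  next
    case False
    then have eq: "enat (Suc N) = supp_size M"
      using assms by (metis Suc_ile_eq antisym_conv2)
    let ?P = "monic_OP M N"
    show thesis
    proof (rule that)
      show "A_poly_prob M (Suc N)
          = smult (of_real (1 / L2_norm_poly M ?P / 2)) (pCons 0 ?P + star_poly ?P)"
        using eq unfolding A_poly_prob_def diff_Suc_1 OP[OF assms] star_poly_smult_real
        by (simp add: smult_add_right mult.commute)
      show "paraorthogonal (Suc N) (pCons 0 ?P + star_poly ?P)"
        using assms by (intro paraorthogonal_shift_monic_OP_plus_star is_monic_OP_monic_OP)
      show "map_poly cnj (pCons 0 ?P + star_poly ?P) = pCons 0 ?P + star_poly ?P"
        using assms by (intro real real_star real_pCons map_poly_cnj_monic_OP)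
      show "1 / L2_norm_poly M ?P / 2 \<noteq> 0" using pos[OF assms] by simp
    qed
  qed
qed

lemma A_poly_prob_paraorthogonal:
  assumes "enat N < supp_size M"
  shows "paraorthogonal (Suc N) (A_poly_prob M (Suc N))"
    and "map_poly cnj (A_poly_prob M (Suc N)) = A_poly_prob M (Suc N)"
  using A_poly_prob_multiple[OF assms]
  by (metis paraorthogonal_smult, metis complex_cnj_complex_of_real complex_cnj_mult
      complex_cnj_zero map_poly_smult)

end

section \<open>The circle as the real line modulo the integers\<close>

lemma ex_to_circle:
  obtains t where "0 \<le> t" "t < 1" "x = to_circle t"
proof -
  obtain s where s: "x = to_circle s" 
    using add_circle.abs_induct[of "\<lambda>x. \<exists>s. x = to_circle s" x] by blast
  have "cong_one s (frac s)" by (simp add: cong_one_def frac_def)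
  then have "x = to_circle (frac s)"
    using s by (simp add: add_circle.abs_eq_iff)
  then show thesis using that frac_ge_0 frac_lt_1 by blast
qed

lemma circle_exp_to_circle [simp]: "circle_exp (to_circle t) = cis (2 * pi * t)"
  by (rule circle_exp.abs_eq)

lemma cmod_circle_exp [simp]: "cmod (circle_exp x) = 1"
  by transfer simp

lemma circle_exp_nonzero [simp]: "circle_exp x \<noteq> 0"
  by (metis cmod_circle_exp norm_zero zero_neq_one)

lemma circle_exp_uminus: "circle_exp (- x) = cnj (circle_exp x)"
  by transfer (simp add: cis_cnj)

lemma inj_circle_exp: "inj circle_exp"
proof (rule injI, transfer)
  fix s t :: real
  assume "cis (2 * pi * s) = cis (2 * pi * t)"
  then obtain n :: int where "2 * pi * s = 2 * pi * t + 2 * pi * of_int n"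
    using sin_cos_eq_iff[of "2 * pi * s" "2 * pi * t"] by (auto simp: complex_eq_iff mult_ac)
  then have "2 * pi * s = 2 * pi * (t + of_int n)" by (simp add: algebra_simps)
  then show "cong_one s t" by (simp add: cong_one_def)
qed

lemma ex_circle_exp:
  assumes "cmod z = 1"
  obtains x where "circle_exp x = z"
proof -
  have "z \<noteq> 0" using assms by auto
  then have "circle_exp (to_circle (Arg z / (2 * pi))) = z"
    using Arg_eq[of z] assms by (simp add: cis_conv_exp)
  then show thesis by (rule that)
qed

lemma dist_to_circle: "dist (to_circle s) (to_circle t) = int_dist (s - t)"
  by (rule dist_add_circle.abs_eq)

lemma dist_to_circle_zero: "dist (to_circle t) 0 = int_dist t"
  by (simp add: zero_add_circle.abs_eq dist_to_circle)

lemma uminus_to_circle: "- to_circle t = to_circle (- t)"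
  by (rule uminus_add_circle.abs_eq)

lemma continuous_to_circle: "continuous_on UNIV to_circle"
proof (rule continuous_on_iff[THEN iffD2], intro ballI allI impI)
  fix t e :: real
  assume "0 < e"
  then show "\<exists>d>0. \<forall>s\<in>UNIV. dist s t < d \<longrightarrow> dist (to_circle s) (to_circle t) < e"
    using int_dist_le[of _ 0] by (intro exI[of _ e]) (auto simp: dist_to_circle dist_real_def
        intro: le_less_trans)
qed

lemma continuous_uminus_add_circle: "continuous_on UNIV (uminus :: add_circle \<Rightarrow> add_circle)"
proof (rule continuous_on_iff[THEN iffD2], intro ballI allI impI)
  fix x :: add_circle and e :: real
  have "dist (- y) (- x) = dist y x" for y
    by transfer (metis int_dist_uminus minus_diff_minus)
  then show "\<exists>d>0. \<forall>y\<in>UNIV. dist y x < d \<longrightarrow> dist (- y) (- x) < e" if "0 < e"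
    using that by (intro exI[of _ e]) auto
qed

lemma dist_circle_exp_le: "dist (circle_exp x) (circle_exp y) \<le> 2 * pi * dist x y"
proof transfer
  fix s t :: real
  define k where "k = round (s - t)"
  have "dist (cis (2 * pi * s)) (cis (2 * pi * t))
      = cmod (cis (2 * pi * t) * (cis (2 * pi * (s - t - k)) - 1))"
  proof -
    have "cis (2 * pi * t) * cis (2 * pi * (s - t - k))
        = cis (2 * pi * s) * cis (2 * pi * of_int (- k))"
      by (simp add: cis_mult algebra_simps)
    also have "cis (2 * pi * of_int (- k)) = 1" by (rule cis_multiple_2pi) simp
    finally show ?thesis by (simp add: dist_norm right_diff_distrib)
  qed
  also have "\<dots> = cmod (exp (\<i> * of_real (2 * pi * (s - t - k))) - 1)"
    by (simp add: norm_mult cis_conv_exp)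
  also have "\<dots> = 2 * \<bar>sin (2 * pi * (s - t - k) / 2)\<bar>"
    by (rule dist_exp_i_1)
  also have "\<dots> \<le> 2 * \<bar>2 * pi * (s - t - k) / 2\<bar>"
    using abs_sin_x_le_abs_x by (intro mult_left_mono) auto
  also have "\<dots> = 2 * pi * int_dist (s - t)"
    by (simp add: int_dist_def k_def abs_mult)
  finally show "dist (cis (2 * pi * s)) (cis (2 * pi * t)) \<le> 2 * pi * int_dist (s - t)" .
qed

lemma continuous_circle_exp: "continuous_on UNIV circle_exp"
proof (rule continuous_on_iff[THEN iffD2], intro ballI allI impI)
  fix x :: add_circle and e :: real
  assume "0 < e"
  then show "\<exists>d>0. \<forall>y\<in>UNIV. dist y x < d \<longrightarrow> dist (circle_exp y) (circle_exp x) < e"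
    by (intro exI[of _ "e / (2 * pi)"])
      (auto simp: field_simps intro: le_less_trans[OF dist_circle_exp_le])
qed

lemma int_dist_eq_self:
  assumes "0 \<le> t" "t \<le> 1 / 2"
  shows "int_dist t = t"
proof (rule antisym)
  show "int_dist t \<le> t" using int_dist_le[of t 0] assms by simp
  have "t \<le> \<bar>t - of_int k\<bar>" for k :: int
    using assms by (cases "k \<le> 0") (auto simp: abs_if dest: of_int_le_0_iff[THEN iffD2])
  then show "t \<le> int_dist t" by (simp add: int_dist_def)
qed

text \<open>
  Since \<open>dist x 0\<close> lies in \<open>[0, 1 / 2]\<close>, it serves as a coordinate on the circle up to sign.
\<close>

lemma dist_zero_cases:
  fixes x :: add_circle
  obtains "0 \<le> dist x 0" "dist x 0 \<le> 1 / 2"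
    "x = to_circle (dist x 0) \<or> x = - to_circle (dist x 0)"
proof -
  obtain t where t: "0 \<le> t" "t < 1" "x = to_circle t" by (rule ex_to_circle)
  show thesis
  proof (cases "t \<le> 1 / 2")
    case True
    then have "dist x 0 = t" using t by (simp add: dist_to_circle_zero int_dist_eq_self)
    then show thesis using that t True by simp
  next
    case False
    have "cong_one t (- (1 - t))" by (simp add: cong_one_def)
    then have x: "x = - to_circle (1 - t)"
      using t by (simp add: uminus_to_circle add_circle.abs_eq_iff)
    then have "dist x 0 = 1 - t"
      using t False int_dist_uminus[of "1 - t"] int_dist_eq_self[of "1 - t"]
      by (simp add: uminus_to_circle dist_to_circle_zero)
    then show thesis using that t False x by simp
  qed
qed

lemma dist_uminus_zero: "dist (- x) 0 = dist x (0 :: add_circle)"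
  by transfer (simp add: int_dist_uminus)

lemma circle_cos_eq: "circle_cos x = cos (2 * pi * dist x 0)"
  by (rule dist_zero_cases[of x]) (metis circle_cos_to_circle cos_minus mult_minus_right
      uminus_to_circle)

lemma circle_cos_less_iff:
  assumes "0 \<le> \<theta>" "\<theta> \<le> 1 / 2"
  shows "circle_cos x < cos (2 * pi * \<theta>) \<longleftrightarrow> \<theta> < dist x 0"
proof -
  have "0 \<le> dist x 0" "dist x 0 \<le> 1 / 2" by (rule dist_zero_cases[of x]; simp)+
  then show ?thesis
    unfolding circle_cos_eq using assms by (subst cos_mono_less_eq) auto
qed

lemma cos_less_circle_cos_iff:
  assumes "0 \<le> \<theta>" "\<theta> \<le> 1 / 2"
  shows "cos (2 * pi * \<theta>) < circle_cos x \<longleftrightarrow> dist x 0 < \<theta>"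
proof -
  have "0 \<le> dist x 0" "dist x 0 \<le> 1 / 2" by (rule dist_zero_cases[of x]; simp)+
  then show ?thesis
    unfolding circle_cos_eq using assms by (subst cos_mono_less_eq) auto
qed

lemma islimpt_add_circle: "(x :: add_circle) islimpt UNIV"
  unfolding islimpt_approachable
proof (intro allI impI)
  fix e :: real
  assume "0 < e"
  obtain t where t: "x = to_circle t" by (rule ex_to_circle)
  define d where "d = min (e / 2) (1 / 2)"
  have d: "0 < d" "d \<le> 1 / 2" "d < e" using \<open>0 < e\<close> by (auto simp: d_def)
  have "dist (to_circle (t + d)) x = d"
    using d by (simp add: t dist_to_circle int_dist_eq_self)
  then show "\<exists>x'\<in>UNIV. x' \<noteq> x \<and> dist x' x < e"
    using d by (intro bexI[of _ "to_circle (t + d)"]) auto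
qed

section \<open>Trigonometric polynomials as polynomials on the unit circle\<close>

definition represents :: "nat \<Rightarrow> complex poly \<Rightarrow> (add_circle \<Rightarrow> real) \<Rightarrow> bool" where
  "represents N G f \<longleftrightarrow> degree G \<le> 2 * N \<and>
     (\<forall>x. complex_of_real (f x) = poly G (circle_exp x) * cnj (circle_exp x) ^ N)"

lemma power_mult_cnj_eq_powi:
  assumes "cmod z = 1"
  shows "z ^ k * cnj z ^ N = z powi (int k - int N)"
proof -
  have "z \<noteq> 0" using assms by auto
  moreover have "cnj z = inverse z"
    using assms by (metis complex_norm_square inverse_unique mult_1 of_real_1 power_one)
  ultimately show ?thesis
    by (simp add: power_int_diff power_inverse divide_inverse)
qed

lemma trig_poly_imp_represents:
  assumes "trig_poly N f"
  obtains G where "represents N G f"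
proof -
  obtain c where c: "\<And>x. complex_of_real (f x) = (\<Sum>n\<in>{- int N..int N}. c n * circle_exp x powi n)"
    using assms by (auto simp: trig_poly_def)
  define G where "G = (\<Sum>n\<in>{- int N..int N}. monom (c n) (nat (n + int N)))"
  have "degree G \<le> 2 * N"
    unfolding G_def by (intro degree_sum_le) (auto intro: order_trans[OF degree_monom_le])
  moreover have "complex_of_real (f x) = poly G (circle_exp x) * cnj (circle_exp x) ^ N" for x
    unfolding c G_def poly_sum sum_distrib_right
  proof (intro sum.cong refl)
    fix n assume "n \<in> {- int N..int N}"
    then show "c n * circle_exp x powi n
        = poly (monom (c n) (nat (n + int N))) (circle_exp x) * cnj (circle_exp x) ^ N"
      using power_mult_cnj_eq_powi[of "circle_exp x" "nat (n + int N)" N]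
      by (simp add: poly_monom mult.assoc)
  qed
  ultimately show thesis using that by (auto simp: represents_def)
qed

lemma represents_imp_trig_poly:
  assumes "represents N G f"
  shows "trig_poly N f"
  unfolding trig_poly_def
proof (intro exI allI)
  fix x
  let ?z = "circle_exp x"
  have "degree G \<le> 2 * N" and f: "complex_of_real (f x) = poly G ?z * cnj ?z ^ N"
    using assms by (auto simp: represents_def)
  then have "poly G ?z = (\<Sum>k\<le>2 * N. coeff G k * ?z ^ k)"
    unfolding poly_altdef by (intro sum.mono_neutral_left) (auto simp: coeff_eq_0)
  then have "complex_of_real (f x) = (\<Sum>k\<le>2 * N. coeff G k * ?z powi (int k - int N))"
    unfolding f by (simp add: sum_distrib_right power_mult_cnj_eq_powi[symmetric] mult.assoc)
  also have "\<dots> = (\<Sum>n\<in>{- int N..int N}. coeff G (nat (n + int N)) * ?z powi n)"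
    by (rule sum.reindex_bij_witness[of _ "\<lambda>n. nat (n + int N)" "\<lambda>k. int k - int N"]) auto
  finally show "complex_of_real (f x)
      = (\<Sum>n\<in>{- int N..int N}. coeff G (nat (n + int N)) * ?z powi n)" .
qed

lemma represents_continuous:
  assumes "represents N G f"
  shows "continuous_on UNIV f"
proof -
  have "f x = Re (poly G (circle_exp x) * cnj (circle_exp x) ^ N)" for x
  proof -
    have "complex_of_real (f x) = poly G (circle_exp x) * cnj (circle_exp x) ^ N"
      using assms by (simp add: represents_def)
    then show ?thesis by (metis Re_complex_of_real)
  qed
  then have "f = (\<lambda>x. Re (poly G (circle_exp x) * cnj (circle_exp x) ^ N))" by (rule ext)
  moreover have "continuous_on UNIV (\<lambda>x. Re (poly G (circle_exp x) * cnj (circle_exp x) ^ N))"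
    by (intro continuous_intros continuous_circle_exp)
  ultimately show ?thesis by (simp only:)
qed

text \<open>
  At an interior minimum the derivative of \<open>f\<close> vanishes. Differentiating the representation
  along the circle at a zero of \<open>G\<close> leaves only the term with \<open>pderiv G\<close>.
\<close>

lemma double_root_if_locally_nonneg:
  assumes rep: "represents N G f" and zero: "f x = 0"
    and "0 < d" and nonneg: "\<And>y. dist y x < d \<Longrightarrow> 0 \<le> f y"
  shows "poly (pderiv G) (circle_exp x) = 0"
proof -
  obtain t where t: "x = to_circle t" by (rule ex_to_circle)
  define c where "c = 2 * of_real pi * \<i>"
  have exp_c: "exp (c * of_real s) = circle_exp (to_circle s)" for s
    by (simp add: c_def cis_conv_exp mult_ac)
  have exp_nc: "exp (- (of_nat N * c * of_real s)) = cnj (circle_exp (to_circle s)) ^ N" for s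
    by (simp add: c_def cis_conv_exp exp_cnj mult_ac flip: exp_of_nat_mult)
  \<comment> \<open>an entire function that restricts to \<open>f\<close> on the real line\<close>
  define \<psi> where "\<psi> w = poly G (exp (c * w)) * exp (- (of_nat N * c * w))" for w
  have \<psi>: "\<psi> (of_real s) = of_real (f (to_circle s))" for s
    using rep unfolding \<psi>_def exp_c exp_nc by (simp add: represents_def)
  have root: "poly G (exp (c * of_real t)) = 0"
    using \<psi>[of t] zero by (simp add: \<psi>_def t)
  define D where "D = poly (pderiv G) (exp (c * of_real t)) * (exp (c * of_real t) * c)
      * exp (- (of_nat N * c * of_real t))"
  have "(\<psi> has_field_derivative D) (at (of_real t))"
    unfolding \<psi>_def D_def
    by (rule derivative_eq_intros refl DERIV_chain2[OF poly_DERIV] | simp add: root)+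
  then have vd: "((\<lambda>s. of_real (f (to_circle s)) :: complex) has_vector_derivative D) (at t)"
    unfolding \<psi>[symmetric] by (rule has_vector_derivative_real_field)
  have "((\<lambda>s. f (to_circle s)) has_vector_derivative Re D) (at t)"
    using bounded_linear.has_vector_derivative[OF bounded_linear_Re vd] by simp
  then have "((\<lambda>s. f (to_circle s)) has_real_derivative Re D) (at t)"
    by (simp add: has_real_derivative_iff_has_vector_derivative)
  then have "Re D = 0"
  proof (rule DERIV_local_min[OF _ \<open>0 < d\<close>], intro allI impI)
    fix s assume "\<bar>t - s\<bar> < d"
    then have "dist (to_circle s) x < d"
      using int_dist_le[of "s - t" 0] by (simp add: t dist_to_circle)
    then show "f (to_circle t) \<le> f (to_circle s)"
      using nonneg zero by (simp add: t)
  qed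
  moreover have "Im D = 0"
    using vector_derivative_unique_at[OF bounded_linear.has_vector_derivative[OF bounded_linear_Im vd]]
    by simp
  ultimately have "D = 0" by (simp add: complex_eq_iff)
  moreover have "c \<noteq> 0" by (simp add: c_def)
  ultimately show ?thesis by (simp add: D_def t exp_c)
qed

text \<open>
  Points at distance exactly \<open>r\<close> are limits of points further away because \<open>r < 1 / 2\<close>.
\<close>

lemma nonneg_outside_closed:
  fixes f :: "add_circle \<Rightarrow> real"
  assumes cont: "continuous_on UNIV f" and r: "0 \<le> r" "r < 1 / 2"
    and nonneg: "\<And>x. r < dist x 0 \<Longrightarrow> 0 \<le> f x"
    and x: "r \<le> dist x 0"
  shows "0 \<le> f x"
proof (cases "r < dist x 0")
  case False
  \<comment> \<open>\<open>\<sigma>\<close> is the identity or the negation, for the two points \<open>to_circle r\<close> and \<open>- to_circle r\<close>\<close>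
  have lim: "0 \<le> f (\<sigma> (to_circle r))"
    if "continuous_on UNIV \<sigma>" "\<And>y. dist (\<sigma> y) 0 = dist y (0 :: add_circle)"
    for \<sigma> :: "add_circle \<Rightarrow> add_circle"
  proof -
    have "continuous_on UNIV (\<lambda>t. f (\<sigma> (to_circle t)))"
      by (intro continuous_on_compose2[OF cont] continuous_on_compose2[OF that(1)]
          continuous_to_circle) auto
    then have "isCont (\<lambda>t. f (\<sigma> (to_circle t))) r"
      by (simp add: continuous_on_eq_continuous_at)
    then have "((\<lambda>t. f (\<sigma> (to_circle t))) \<longlongrightarrow> f (\<sigma> (to_circle r))) (at_right r)"
      unfolding isCont_def by (rule filterlim_mono) (auto simp: at_within_le_at)
    moreover have "\<forall>\<^sub>F t in at_right r. 0 \<le> f (\<sigma> (to_circle t))"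
    proof -
      have "\<forall>\<^sub>F t in at_right r. t < 1 / 2"
        using r(2) by (intro order_tendstoD(2)[OF tendsto_ident_at]) auto
      moreover have "\<forall>\<^sub>F t in at_right r. r < t" by (rule eventually_at_right_less)
      ultimately show ?thesis
      proof eventually_elim
        case (elim t)
        then have "dist (\<sigma> (to_circle t)) 0 = t"
          using r(1) by (simp add: that(2) dist_to_circle_zero int_dist_eq_self)
        then show ?case using nonneg elim by simp
      qed
    qed
    ultimately show ?thesis by (rule tendsto_lowerbound) simp
  qed
  have "x = to_circle r \<or> x = - to_circle r"
    using False x by (rule_tac dist_zero_cases[of x]) auto
  then show ?thesis
    using lim[of "\<lambda>y. y"] lim[OF continuous_uminus_add_circle dist_uminus_zero]
    by auto
qed (rule nonneg)

section \<open>The radius of last sign change\<close>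

definition nonneg_radii :: "(add_circle \<Rightarrow> real) \<Rightarrow> real set" where
  "nonneg_radii f = {r. r > 0 \<and> (\<forall>x. x \<notin> ball 0 r \<longrightarrow> f x \<ge> 0)}"

lemma last_sign_change_eq: "last_sign_change f = Inf (nonneg_radii f)"
  by (simp add: last_sign_change_def nonneg_radii_def)

text \<open>
  The ball of radius \<open>1\<close> is the whole circle. Consequently the infimum defining
  \<open>last_sign_change\<close> is never over the empty set.
\<close>

lemma one_in_nonneg_radii: "1 \<in> nonneg_radii f"
proof -
  have "x \<in> ball 0 1" for x :: add_circle
    by (rule dist_zero_cases[of x]) (simp add: dist_commute)
  then show ?thesis by (simp add: nonneg_radii_def)
qed

lemma eventually_nonneg_add_circle: "eventually_nonneg f"
  using one_in_nonneg_radii[of f]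
  unfolding nonneg_radii_def eventually_nonneg_def by blast

lemma last_sign_change_nonneg: "0 \<le> last_sign_change f"
  unfolding last_sign_change_eq
proof (rule cInf_greatest)
  show "nonneg_radii f \<noteq> {}" using one_in_nonneg_radii by blast
qed (simp add: nonneg_radii_def)

lemma nonneg_beyond_last_sign_change:
  assumes "last_sign_change f < s"
  obtains r where "0 < r" "r < s" "\<And>x. r \<le> dist x 0 \<Longrightarrow> 0 \<le> f x"
proof -
  obtain r where "r \<in> nonneg_radii f" "r < s"
    using assms one_in_nonneg_radii[of f] unfolding last_sign_change_eq
    by (metis cInf_lessD empty_iff)
  then show thesis
    using that by (auto simp: nonneg_radii_def dist_commute not_less)
qed

section \<open>Even measures and their image on the unit circle\<close>

locale even_circle_measure = finite_measure \<mu> for \<mu> :: "add_circle measure" +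
  assumes sets_eq: "sets \<mu> = sets borel"
    and even: "\<And>A. A \<in> sets borel \<Longrightarrow> emeasure \<mu> A = emeasure \<mu> (uminus ` A)"
begin

lemma space_eq: "space \<mu> = UNIV"
  using sets_eq_imp_space_eq[OF sets_eq] by simp

lemma borel_measurable_continuous:
  fixes f :: "add_circle \<Rightarrow> 'b :: topological_space"
  assumes "continuous_on UNIV f"
  shows "f \<in> borel_measurable \<mu>"
  using borel_measurable_continuous_onI[OF assms] sets_eq measurable_cong_sets by blast

lemmas measurable_circle_exp = borel_measurable_continuous[OF continuous_circle_exp]

definition "mass = measure \<mu> UNIV"

text \<open>
  The measure that the polynomials \<open>A_poly \<mu> n\<close> belong to.
\<close>

definition "\<nu> = normalize_measure (circle_measure \<mu>)"

lemma A_poly_eq: "A_poly \<mu> n = A_poly_prob \<nu> n"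
  by (simp add: A_poly_def \<nu>_def)

lemma mass_pos:
  assumes "supp_size \<mu> \<noteq> 0"
  shows "mass > 0"
proof -
  have "msupp \<mu> \<noteq> {}" using assms by (auto simp: supp_size_def zero_enat_def)
  then have "emeasure \<mu> UNIV > 0" unfolding msupp_def by fastforce
  then show ?thesis by (simp add: mass_def emeasure_eq_measure)
qed

context
  assumes pos: "mass > 0"
begin

lemma emeasure_\<nu>:
  assumes "A \<in> sets borel"
  shows "emeasure \<nu> A = ennreal (1 / mass) * emeasure \<mu> (circle_exp -` A)"
proof -
  have distr: "emeasure (circle_measure \<mu>) A = emeasure \<mu> (circle_exp -` A)" if "A \<in> sets borel" for A
    using that by (simp add: circle_measure_def emeasure_distr[OF measurable_circle_exp] space_eq)
  have "emeasure (circle_measure \<mu>) (space (circle_measure \<mu>)) = ennreal mass"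
    using distr[of UNIV] by (simp add: circle_measure_def mass_def emeasure_eq_measure)
  then show ?thesis
    using distr[OF assms] pos by (simp add: \<nu>_def normalize_measure_def inverse_ennreal divide_inverse)
qed

lemma sets_\<nu>: "sets \<nu> = sets borel"
  by (simp add: \<nu>_def normalize_measure_def circle_measure_def)

lemma integral_\<nu>:
  fixes h :: "complex \<Rightarrow> complex"
  assumes "continuous_on UNIV h"
  shows "(LINT x|\<mu>. h (circle_exp x)) = of_real mass * (LINT z|\<nu>. h z)"
proof -
  have h: "h \<in> borel_measurable borel" by (rule borel_measurable_continuous_onI) fact
  have "\<nu> = density (circle_measure \<mu>) (\<lambda>_. ennreal (1 / mass))"
  proof (rule measure_eqI)
    fix A assume "A \<in> sets \<nu>"
    then have "A \<in> sets borel" by (simp add: sets_\<nu>)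
    then show "emeasure \<nu> A = emeasure (density (circle_measure \<mu>) (\<lambda>_. ennreal (1 / mass))) A"
      by (simp add: emeasure_\<nu> emeasure_density_const circle_measure_def
          emeasure_distr[OF measurable_circle_exp] space_eq)
  qed (simp add: sets_\<nu> circle_measure_def)
  then have "(LINT z|\<nu>. h z) = (LINT z|circle_measure \<mu>. (1 / mass) *\<^sub>R h z)"
    using pos h by (simp add: integral_density circle_measure_def)
  also have "\<dots> = (1 / mass) *\<^sub>R (LINT x|\<mu>. h (circle_exp x))"
    unfolding circle_measure_def using h by (simp add: integral_distr[OF measurable_circle_exp])
  finally show ?thesis using pos by (simp add: scaleR_conv_of_real)
qed

lemma symmetric_\<nu>: "symmetric_circle_supported \<nu>"
proof -
  have sp: "space \<nu> = UNIV" using sets_eq_imp_space_eq[OF sets_\<nu>] by simp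
  interpret fin: finite_measure \<nu>
    by (rule finite_measureI) (simp add: sp emeasure_\<nu> emeasure_eq_measure ennreal_mult_eq_top_iff)
  have "{z. cmod z \<noteq> 1} \<in> sets borel"
    by (intro borel_open open_Collect_neq continuous_intros)
  moreover have "circle_exp -` {z. cmod z \<noteq> 1} = {}" by auto
  ultimately have "{z. cmod z \<noteq> 1} \<in> null_sets \<nu>"
    by (simp add: null_sets_def sets_\<nu> emeasure_\<nu>)
  then have ae: "AE z in \<nu>. cmod z = 1" by (rule AE_I') auto
  have cnj_meas: "cnj \<in> measurable \<nu> borel"
    using measurable_cong_sets[OF sets_\<nu> refl]
      borel_measurable_continuous_onI[OF continuous_on_cnj[OF continuous_on_id]] by blast
  have "distr \<nu> borel cnj = \<nu>"
  proof (rule measure_eqI)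
    fix A assume "A \<in> sets (distr \<nu> borel cnj)"
    then have A: "A \<in> sets borel" by simp
    have cnjA: "cnj -` A \<in> sets borel"
      using measurable_sets[OF cnj_meas A] by (simp add: sp sets_\<nu>)
    have expA: "circle_exp -` A \<in> sets borel"
      using measurable_sets[OF measurable_circle_exp A] by (simp add: space_eq sets_eq)
    have "x \<in> uminus ` S \<longleftrightarrow> - x \<in> S" for x :: add_circle and S
    proof
      assume "x \<in> uminus ` S"
      then obtain y where "x = - y" "y \<in> S" by (rule imageE)
      then show "- x \<in> S" by simp
    next
      assume "- x \<in> S"
      then show "x \<in> uminus ` S" using imageI[of "- x" S uminus] by simp
    qed
    then have "circle_exp -` (cnj -` A) = uminus ` (circle_exp -` A)"
      by (simp add: set_eq_iff circle_exp_uminus)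
    then show "emeasure (distr \<nu> borel cnj) A = emeasure \<nu> A"
      using even[OF expA] by (simp add: emeasure_distr[OF cnj_meas A] sp emeasure_\<nu> A cnjA)
  qed (simp add: sets_\<nu>)
  then show ?thesis
    by unfold_locales (use sets_\<nu> ae in auto)
qed

lemma supp_size_le: "supp_size \<mu> \<le> supp_size \<nu>"
proof -
  have sub: "circle_exp ` msupp \<mu> \<subseteq> msupp \<nu>"
  proof (clarsimp simp: msupp_def)
    fix x U
    assume x: "\<forall>V. open V \<longrightarrow> x \<in> V \<longrightarrow> 0 < emeasure \<mu> V" and U: "open U" "circle_exp x \<in> U"
    have "open (circle_exp -` U)"
      using U(1) continuous_circle_exp by (rule open_vimage)
    then have "0 < emeasure \<mu> (circle_exp -` U)" using x U(2) by simp
    then show "0 < emeasure \<nu> U"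
      using U(1) pos by (simp add: emeasure_\<nu> ennreal_zero_less_mult_iff)
  qed
  show ?thesis
  proof (cases "finite (msupp \<nu>)")
    case True
    then have "finite (circle_exp ` msupp \<mu>)" using sub finite_subset by blast
    then have "finite (msupp \<mu>)"
      using inj_circle_exp by (metis finite_imageD inj_on_subset subset_UNIV)
    moreover have "card (msupp \<mu>) \<le> card (msupp \<nu>)"
      using True sub inj_circle_exp by (metis card_image card_mono inj_on_subset subset_UNIV)
    ultimately show ?thesis using True by (simp add: supp_size_def)
  qed (simp add: supp_size_def)
qed

end

lemma integral_represents:
  assumes pos: "mass > 0" and rep: "represents N G f"
  shows "complex_of_real (LINT x|\<mu>. f x)
    = of_real mass * (LINT z|\<nu>. poly G z * cnj (poly (monom 1 N) z))"
proof -
  have "complex_of_real (LINT x|\<mu>. f x) = (LINT x|\<mu>. complex_of_real (f x))"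
    by simp
  also have "\<dots> = (LINT x|\<mu>. poly G (circle_exp x) * cnj (poly (monom 1 N) (circle_exp x)))"
    using rep by (simp add: represents_def poly_monom)
  also have "\<dots> = of_real mass * (LINT z|\<nu>. poly G z * cnj (poly (monom 1 N) z))"
    by (intro integral_\<nu>[OF pos] continuous_intros)
  finally show ?thesis .
qed

section \<open>Measures with few support points\<close>

text \<open>
  The complement of the support is a union of open null sets. Countably many of them suffice:
  their preimages under \<open>to_circle\<close> are open sets of reals, which have the Lindelof property.
\<close>

lemma AE_in_msupp: "AE x in \<mu>. x \<in> msupp \<mu>"
proof -
  define \<U> where "\<U> = {U :: add_circle set. open U \<and> emeasure \<mu> U = 0}"
  have compl: "- msupp \<mu> = \<Union>\<U>"
    by (auto simp: msupp_def \<U>_def zero_less_iff_neq_zero)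
  obtain \<W> where \<W>: "\<W> \<subseteq> (\<lambda>U. to_circle -` U) ` \<U>" "countable \<W>"
      "\<Union>\<W> = (\<Union>U\<in>\<U>. to_circle -` U)"
    by (rule Lindelof[of "(\<lambda>U. to_circle -` U) ` \<U>"])
      (auto simp: \<U>_def intro: open_vimage[OF _ continuous_to_circle])
  then obtain \<V> where \<V>: "countable \<V>" "\<V> \<subseteq> \<U>" "\<W> = (\<lambda>U. to_circle -` U) ` \<V>"
    by (metis countable_subset_image)
  have "\<Union>\<U> \<subseteq> \<Union>\<V>"
  proof
    fix x assume "x \<in> \<Union>\<U>"
    moreover obtain t where "x = to_circle t" by (rule ex_to_circle)
    ultimately have "t \<in> \<Union>\<W>" using \<W>(3) by auto
    then show "x \<in> \<Union>\<V>" using \<V>(3) \<open>x = to_circle t\<close> by auto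
  qed
  moreover have "(\<Union>V\<in>\<V>. V) \<in> null_sets \<mu>"
    using \<V> by (intro null_sets_UN') (auto simp: \<U>_def null_sets_def sets_eq)
  ultimately show ?thesis
    using compl by (intro AE_I'[of "\<Union>\<V>"]) (simp, blast)
qed

text \<open>
  The function \<open>\<bar>P\<bar>\<^sup>2\<close> for the polynomial \<open>P\<close> whose roots are the support points is
  non-negative everywhere and vanishes almost everywhere.
\<close>

lemma rho_eq_zero_if_supp_size_le:
  assumes "supp_size \<mu> \<le> enat N"
  shows "rho \<mu> N = 0"
proof -
  have fin: "finite (msupp \<mu>)" and card: "card (msupp \<mu>) \<le> N"
    using assms by (auto simp: supp_size_def split: if_splits)
  define P where "P = (\<Prod>x\<in>msupp \<mu>. [:- circle_exp x, 1:])"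
  have P_deg: "degree P = card (msupp \<mu>)"
    unfolding P_def by (subst degree_prod_eq_sum_degree) auto
  have P_root: "poly P (circle_exp x) = 0 \<longleftrightarrow> x \<in> msupp \<mu>" for x
    using fin inj_circle_exp by (auto simp: P_def poly_prod prod_zero_iff inj_eq)
  define f where "f x = (cmod (poly P (circle_exp x)))\<^sup>2" for x
  \<comment> \<open>the monomial pads \<open>z ^ degree P * \<bar>P z\<bar>\<^sup>2\<close> to \<open>z ^ N * \<bar>P z\<bar>\<^sup>2\<close>\<close>
  have "represents N (monom 1 (N - degree P) * (P * star_poly P)) f"
    unfolding represents_def
  proof (intro conjI allI)
    have "degree (monom 1 (N - degree P) * (P * star_poly P))
        \<le> (N - degree P) + (degree P + degree P)"
      using degree_star_poly_le[of P]
      by (intro order_trans[OF degree_mult_le] add_mono order_trans[OF degree_monom_le])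
        (auto intro: order_trans[OF degree_mult_le])
    then show "degree (monom 1 (N - degree P) * (P * star_poly P)) \<le> 2 * N"
      using P_deg card by simp
    fix x
    let ?z = "circle_exp x"
    have "?z ^ (N - degree P) * ?z ^ degree P = ?z ^ N"
      using P_deg card by (simp flip: power_add)
    then have "poly (monom 1 (N - degree P) * (P * star_poly P)) ?z * cnj ?z ^ N
        = (?z ^ N * cnj (?z ^ N)) * (poly P ?z * cnj (poly P ?z))"
      by (simp add: poly_monom star_poly_on_circle mult_ac)
    then show "complex_of_real (f x)
        = poly (monom 1 (N - degree P) * (P * star_poly P)) ?z * cnj ?z ^ N"
      by (simp only: unit_power_mult_cnj[OF cmod_circle_exp] f_def mult_1 complex_norm_square)
  qed
  then have "trig_poly N f" by (rule represents_imp_trig_poly)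
  moreover have "(LINT x|\<mu>. f x) = 0"
    using AE_in_msupp by (intro integral_eq_zero_AE) (auto simp: f_def P_root)
  ultimately have adm: "f \<in> admissible \<mu> N"
    by (simp add: admissible_def eventually_nonneg_add_circle)
  have "\<exists>x. x \<notin> msupp \<mu>"
    using fin islimpt_finite[of UNIV] islimpt_add_circle by (metis UNIV_eq_I)
  then have "f \<noteq> (\<lambda>_. 0)" by (auto simp: f_def P_root fun_eq_iff)
  moreover have "last_sign_change f = 0"
  proof -
    have "nonneg_radii f = {0<..}" by (auto simp: nonneg_radii_def f_def)
    then show ?thesis by (simp add: last_sign_change_eq)
  qed
  ultimately show ?thesis
    unfolding rho_def using adm last_sign_change_nonneg
    by (intro cInf_eq_minimum) (auto intro: rev_image_eqI)
qed

end

section \<open>The extremal problem\<close>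

locale extremal_problem = even_circle_measure +
  fixes N :: nat
  assumes N_pos: "1 \<le> N" and N_less: "enat N < supp_size \<mu>"
begin

lemma mass: "mass > 0"
  using N_less by (intro mass_pos) auto

sublocale nu: symmetric_circle_supported \<nu>
  by (rule symmetric_\<nu>[OF mass])

lemma N_less_\<nu>: "enat N < supp_size \<nu>" "enat (Suc N) \<le> supp_size \<nu>"
proof -
  show "enat N < supp_size \<nu>" using N_less supp_size_le[OF mass] by (rule less_le_trans)
  then show "enat (Suc N) \<le> supp_size \<nu>" by (simp add: Suc_ile_eq)
qed

definition "B = A_poly \<mu> (Suc N)"

lemma B_paraorthogonal: "nu.paraorthogonal (Suc N) B"
  and B_real: "map_poly cnj B = B"
  unfolding B_def A_poly_eq using nu.A_poly_prob_paraorthogonal[OF N_less_\<nu>(1)] by auto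

lemma B_degree: "degree B = Suc N" and B_star: "star_poly B = B" and B_nonzero: "B \<noteq> 0"
  using B_paraorthogonal by (auto simp: nu.paraorthogonal_def)

lemmas B_roots = nu.paraorthogonal_roots[OF B_paraorthogonal _ N_less_\<nu>(2), simplified]

lemma pderiv_B_nonzero: "poly B a = 0 \<Longrightarrow> poly (pderiv B) a \<noteq> 0"
  using B_roots(2) rsquarefree_roots by blast

lemma B_cnj: "poly B (cnj z) = cnj (poly B z)"
  using poly_map_poly_cnj[of B "cnj z"] B_real by simp

definition nodes :: "add_circle set" where
  "nodes = {x. poly B (circle_exp x) = 0}"

lemma circle_exp_nodes: "circle_exp ` nodes = {a. poly B a = 0}"
  using B_roots(1) ex_circle_exp by (auto simp: nodes_def image_iff) metis

lemma inj_on_circle_exp: "inj_on circle_exp S"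
  using inj_circle_exp inj_on_subset by blast

lemma card_nodes: "card nodes = Suc N"
  using B_roots(3) card_image[OF inj_on_circle_exp, of nodes] by (simp add: circle_exp_nodes)

lemma finite_nodes: "finite nodes"
  using card_nodes by (metis card.infinite nat.distinct(1))

lemma uminus_nodes: "x \<in> nodes \<Longrightarrow> - x \<in> nodes"
  by (simp add: nodes_def circle_exp_uminus B_cnj)

lemma zero_not_node: "0 \<notin> nodes"
  using nu.paraorthogonal_one_not_root[OF B_paraorthogonal _ N_less_\<nu>(2) B_real]
  by (simp add: nodes_def zero_add_circle.abs_eq)

lemma quadrature:
  "\<exists>w. (\<forall>x\<in>nodes. w x > 0) \<and>
     (\<forall>f G. represents N G f \<longrightarrow> (LINT x|\<mu>. f x) = (\<Sum>x\<in>nodes. w x * f x))"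
proof -
  obtain W where W: "\<And>a. poly B a = 0 \<Longrightarrow> W a > 0"
      "\<And>G. degree G \<le> 2 * N \<Longrightarrow>
        nu.ip G (monom 1 N) = (\<Sum>a | poly B a = 0. of_real (W a) * (poly G a * cnj a ^ N))"
    using nu.paraorthogonal_quadrature[OF B_paraorthogonal N_less_\<nu>(1)] by auto
  show ?thesis
  proof (intro exI conjI ballI allI impI)
    show "mass * W (circle_exp x) > 0" if "x \<in> nodes" for x
      using that mass W(1) by (simp add: nodes_def)
    fix f G
    assume rep: "represents N G f"
    have "complex_of_real (LINT x|\<mu>. f x) = of_real mass * nu.ip G (monom 1 N)"
      using integral_represents[OF mass rep] by (simp add: nu.ip_def)
    also have "\<dots> = of_real mass
        * (\<Sum>a\<in>circle_exp ` nodes. of_real (W a) * (poly G a * cnj a ^ N))"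
      using rep by (simp add: W(2) represents_def circle_exp_nodes)
    also have "\<dots> = of_real (\<Sum>x\<in>nodes. mass * W (circle_exp x) * f x)"
      using rep by (simp add: sum.reindex[OF inj_on_circle_exp] sum_distrib_left represents_def mult.assoc)
    finally show "(LINT x|\<mu>. f x) = (\<Sum>x\<in>nodes. mass * W (circle_exp x) * f x)"
      by (simp only: of_real_eq_iff)
  qed
qed

definition \<theta> :: real where
  "\<theta> = Min ((\<lambda>x. dist x 0) ` nodes)"

lemma \<theta>_le: "x \<in> nodes \<Longrightarrow> \<theta> \<le> dist x 0"
  using finite_nodes by (simp add: \<theta>_def)

lemma \<theta>_nodes: "to_circle \<theta> \<in> nodes" "- to_circle \<theta> \<in> nodes"
proof -
  have "nodes \<noteq> {}" using card_nodes by auto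
  then have "\<theta> \<in> (\<lambda>x. dist x 0) ` nodes"
    unfolding \<theta>_def using finite_nodes by (intro Min_in) auto
  then obtain x where x: "x \<in> nodes" "\<theta> = dist x 0" by auto
  then have "x = to_circle \<theta> \<or> x = - to_circle \<theta>" by (metis dist_zero_cases)
  then show "to_circle \<theta> \<in> nodes" "- to_circle \<theta> \<in> nodes"
    using x(1) uminus_nodes[of x] by auto
qed

lemma \<theta>_pos: "0 < \<theta>"
proof -
  have "nodes \<noteq> {}" using card_nodes by auto
  then have "\<theta> \<in> (\<lambda>x. dist x 0) ` nodes"
    unfolding \<theta>_def using finite_nodes by (intro Min_in) auto
  then show ?thesis using zero_not_node by auto
qed

text \<open>
  If the nearest nodes were at distance \<open>1 / 2\<close>, the antipode of \<open>0\<close> would be the only node,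
  but there are \<open>N + 1 \<ge> 2\<close> of them. The bound matters because at the antipode \<open>\<theta>\<close> and \<open>- \<theta>\<close>
  would coincide.
\<close>

lemma \<theta>_less_half: "\<theta> < 1 / 2"
proof (rule ccontr)
  assume "\<not> \<theta> < 1 / 2"
  have "nodes \<subseteq> {to_circle (1 / 2)}"
  proof
    fix x assume "x \<in> nodes"
    then have "1 / 2 \<le> dist x 0" using \<theta>_le \<open>\<not> \<theta> < 1 / 2\<close> by fastforce
    then have "x = to_circle (1 / 2) \<or> x = - to_circle (1 / 2)"
      by (rule_tac dist_zero_cases[of x]) (metis antisym)
    moreover have "- to_circle (1 / 2) = to_circle (1 / 2)"
      by (simp add: uminus_to_circle add_circle.abs_eq_iff cong_one_def)
    ultimately show "x \<in> {to_circle (1 / 2)}" by auto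
  qed
  then have "card nodes \<le> 1" using card_mono[of "{to_circle (1 / 2)}" nodes] by simp
  then show False using card_nodes N_pos by simp
qed

lemma dist_\<theta>: "dist (to_circle \<theta>) 0 = \<theta>" "dist (- to_circle \<theta>) 0 = \<theta>"
  using \<theta>_pos \<theta>_less_half
  by (simp_all add: dist_uminus_zero dist_to_circle_zero int_dist_eq_self)

lemma dist_eq_\<theta>D: "dist x 0 = \<theta> \<Longrightarrow> x = to_circle \<theta> \<or> x = - to_circle \<theta>"
  by (metis dist_zero_cases)

text \<open>
  By the quadrature rule, a positive combination of these non-negative values is at most zero.
\<close>

lemma vanishes_at_nodes:
  assumes f: "f \<in> admissible \<mu> N" and nonneg: "\<And>x. x \<in> nodes \<Longrightarrow> 0 \<le> f x"
    and x: "x \<in> nodes"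
  shows "f x = 0"
proof -
  obtain G where "represents N G f"
    using f trig_poly_imp_represents by (auto simp: admissible_def)
  moreover obtain w where w: "\<And>x. x \<in> nodes \<Longrightarrow> w x > 0"
    and "\<And>f G. represents N G f \<Longrightarrow> (LINT x|\<mu>. f x) = (\<Sum>x\<in>nodes. w x * f x)"
    using quadrature by auto
  ultimately have "(\<Sum>x\<in>nodes. w x * f x) \<le> 0"
    using f by (auto simp: admissible_def)
  moreover have wf: "0 \<le> w x * f x" if "x \<in> nodes" for x
    using w[OF that] nonneg[OF that] by simp
  ultimately have "(\<Sum>x\<in>nodes. w x * f x) = 0" by (intro antisym sum_nonneg) auto
  then have "w x * f x = 0"
    using wf x finite_nodes by (simp add: sum_nonneg_eq_0_iff)
  then show ?thesis using w[OF x] by simp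
qed

text \<open>
  The competitor vanishes at all nodes, so its polynomial is divisible by \<open>B\<close>. At a node beyond
  \<open>r\<close> it has a local minimum, hence a double root there; as the roots of \<open>B\<close> are simple, the
  cofactor \<open>H\<close> shares it.
\<close>

lemma competitor_factorization:
  assumes f: "f \<in> admissible \<mu> N" and r: "0 \<le> r" "r \<le> \<theta>"
    and nonneg: "\<And>x. r < dist x 0 \<Longrightarrow> 0 \<le> f x"
  shows "\<exists>H. represents N (B * H) f \<and> degree H < N \<and>
    (\<forall>x\<in>nodes. r < dist x 0 \<longrightarrow> poly H (circle_exp x) = 0)"
proof -
  obtain G where rep: "represents N G f"
    using f trig_poly_imp_represents by (auto simp: admissible_def)
  have "0 \<le> f x" if "x \<in> nodes" for x
    using nonneg_outside_closed[OF represents_continuous[OF rep] r(1) _ nonneg]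
      r(2) \<theta>_less_half \<theta>_le[OF that] by simp
  then have zero: "f x = 0" if "x \<in> nodes" for x
    using vanishes_at_nodes[OF f] that by blast
  have G_zero: "poly G (circle_exp x) = 0" if "x \<in> nodes" for x
  proof -
    have "complex_of_real (f x) = poly G (circle_exp x) * cnj (circle_exp x) ^ N"
      using rep by (simp add: represents_def)
    then show ?thesis using zero[OF that] by simp
  qed
  define H where "H = G div B"
  have "G mod B = 0"
  proof (rule poly_eqI_degree[where A = "circle_exp ` nodes"])
    show "poly (G mod B) a = poly 0 a" if "a \<in> circle_exp ` nodes" for a
    proof -
      have "poly B a = 0" "poly G a = 0" using that G_zero by (auto simp: nodes_def)
      moreover have "G mod B = G - H * B" by (simp add: H_def minus_div_mult_eq_mod)
      ultimately show ?thesis by simp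
    qed
    show "degree (G mod B) < card (circle_exp ` nodes)"
      using degree_mod_less[OF B_nonzero, of G] B_degree
      by (auto simp: card_image[OF inj_on_circle_exp] card_nodes)
    show "degree (0 :: complex poly) < card (circle_exp ` nodes)"
      by (simp add: card_image[OF inj_on_circle_exp] card_nodes)
  qed
  then have G: "G = B * H" by (simp add: H_def mod_eq_0_iff_dvd)
  show ?thesis
  proof (intro exI conjI ballI impI)
    show "represents N (B * H) f" using rep G by simp
    show "degree H < N"
    proof (cases "H = 0")
      case False
      then have "degree G = Suc N + degree H"
        using B_nonzero B_degree by (simp add: G degree_mult_eq)
      then show ?thesis using rep by (simp add: represents_def)
    qed (use N_pos in simp)
    fix x assume x: "x \<in> nodes" "r < dist x 0"
    have "poly (pderiv G) (circle_exp x) = 0"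
    proof (rule double_root_if_locally_nonneg[OF rep zero[OF x(1)]])
      show "0 < dist x 0 - r" using x(2) by simp
      fix y assume "dist y x < dist x 0 - r"
      then show "0 \<le> f y" using dist_triangle[of x 0 y] by (intro nonneg) (simp add: dist_commute)
    qed
    then show "poly H (circle_exp x) = 0"
      using x(1) pderiv_B_nonzero[of "circle_exp x"] by (simp add: G pderiv_mult nodes_def)
  qed
qed

text \<open>
  Otherwise the cofactor \<open>H\<close>, of degree less than \<open>N\<close>, has all \<open>N + 1\<close> nodes as roots.
\<close>

lemma \<theta>_le_last_sign_change:
  assumes f: "f \<in> admissible \<mu> N" and "f \<noteq> (\<lambda>_. 0)"
  shows "\<theta> \<le> last_sign_change f"
proof (rule ccontr)
  assume "\<not> ?thesis"
  then obtain r where r: "0 < r" "r < \<theta>" "\<And>x. r \<le> dist x 0 \<Longrightarrow> 0 \<le> f x"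
    by (metis nonneg_beyond_last_sign_change not_le)
  then obtain H where H: "represents N (B * H) f" "degree H < N"
      "\<And>x. x \<in> nodes \<Longrightarrow> r < dist x 0 \<Longrightarrow> poly H (circle_exp x) = 0"
    using competitor_factorization[OF f, of r] by auto
  have "H = 0"
  proof (rule poly_eqI_degree[where A = "circle_exp ` nodes"])
    show "poly H a = poly 0 a" if "a \<in> circle_exp ` nodes" for a
      using that H(3) \<theta>_le r(2) by fastforce
  qed (use H(2) in \<open>simp_all add: card_image[OF inj_on_circle_exp] card_nodes\<close>)
  then have "f = (\<lambda>_. 0)" using H(1) by (simp add: represents_def fun_eq_iff)
  then show False using assms(2) by contradiction
qed

text \<open>
  The cofactor of \<open>B\<close> after removing the two nodes \<open>\<theta>\<close> and \<open>- \<theta>\<close>; its roots are the remaining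
  nodes. The divisor is the real form of \<open>(z - a) * (z - cnj a)\<close> with \<open>a = cis (2 * pi * \<theta>)\<close>.
\<close>

definition C :: "complex poly" where
  "C = B div [:1, - 2 * of_real (cos (2 * pi * \<theta>)), 1:]"

lemma B_eq: "B = [:1, - 2 * of_real (cos (2 * pi * \<theta>)), 1:] * C"
proof -
  define a where "a = circle_exp (to_circle \<theta>)"
  have a: "poly B a = 0" "poly B (cnj a) = 0"
    using \<theta>_nodes by (simp_all add: nodes_def a_def circle_exp_uminus)
  have "Im a \<noteq> 0"
  proof -
    have "0 < sin (2 * pi * \<theta>)"
      using \<theta>_pos \<theta>_less_half by (intro sin_gt_zero) auto
    then show ?thesis by (simp add: a_def)
  qed
  then have "cnj a \<noteq> a" by (auto simp: complex_eq_iff)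
  define R where "R = B div [:- a, 1:]"
  have R: "B = [:- a, 1:] * R" unfolding R_def using a(1) by (rule poly_eq_linear_factor_div)
  have "poly B (cnj a) = (cnj a - a) * poly R (cnj a)" by (subst R) (simp add: algebra_simps)
  then have "poly R (cnj a) = 0" using a(2) \<open>cnj a \<noteq> a\<close> by simp
  then have "[:- cnj a, 1:] dvd R" by (simp add: poly_eq_0_iff_dvd)
  then have "[:- a, 1:] * [:- cnj a, 1:] dvd B" unfolding R by (rule mult_dvd_mono[OF dvd_refl])
  also have "[:- a, 1:] * [:- cnj a, 1:] = [:1, - 2 * of_real (cos (2 * pi * \<theta>)), 1:]"
    by (simp add: a_def complex_eq_iff flip: power2_eq_square)
  finally show ?thesis by (simp only: C_def dvd_mult_div_cancel)
qed

text \<open>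
  On the circle \<open>z\<^sup>2 + 1 = z * (z + cnj z) = 2 * z * Re z\<close>, so the quadratic factor is
  \<open>2 * z * (Re z - cos (2 * pi * \<theta>))\<close>, which is the denominator of the extremal quotient up to
  the factor \<open>- 2 * z\<close>.
\<close>

lemma poly_B_circle_exp:
  "poly B (circle_exp x)
    = of_real (2 * (circle_cos x - cos (2 * pi * \<theta>))) * circle_exp x * poly C (circle_exp x)"
proof -
  let ?z = "circle_exp x"
  have "?z * cnj ?z = 1" using unit_power_mult_cnj[of ?z 1] by simp
  then have "1 + ?z * ?z = ?z * (?z + cnj ?z)" by (simp add: algebra_simps)
  also have "\<dots> = of_real (2 * circle_cos x) * ?z"
    by (simp add: complex_add_cnj circle_cos_def)
  finally have "1 + ?z * ?z = of_real (2 * circle_cos x) * ?z" .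
  then have "poly [:1, - 2 * of_real (cos (2 * pi * \<theta>)), 1:] ?z
      = of_real (2 * (circle_cos x - cos (2 * pi * \<theta>))) * ?z"
    by (simp add: algebra_simps)
  then show ?thesis by (subst B_eq) (simp only: poly_mult)
qed

lemma C_nonzero: "C \<noteq> 0" and C_degree: "degree C = N - 1"
proof -
  show C: "C \<noteq> 0" using B_eq B_nonzero by auto
  have "degree B = 2 + degree C"
    by (subst B_eq) (use C in \<open>simp add: degree_mult_eq del: mult_pCons_left mult_pCons_right\<close>)
  then show "degree C = N - 1" using B_degree by simp
qed

lemma C_at_\<theta>: "poly C (circle_exp (to_circle \<theta>)) \<noteq> 0"
proof
  let ?a = "circle_exp (to_circle \<theta>)" and ?q = "[:1, - 2 * of_real (cos (2 * pi * \<theta>)), 1:] :: complex poly"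
  assume "poly C ?a = 0"
  moreover have "poly ?q ?a = 0"
  proof -
    have "1 + ?a * ?a = ?a * (?a + cnj ?a)"
      using unit_power_mult_cnj[of ?a 1] by (simp add: algebra_simps)
    then show ?thesis by (simp add: complex_add_cnj algebra_simps)
  qed
  ultimately have "poly (pderiv B) ?a = 0"
    by (subst B_eq) (simp only: pderiv_mult poly_add poly_mult, simp)
  then show False using pderiv_B_nonzero[of ?a] \<theta>_nodes by (simp add: nodes_def)
qed

lemma C_at_other_nodes:
  assumes "x \<in> nodes" and "dist x 0 \<noteq> \<theta>"
  shows "poly C (circle_exp x) = 0"
proof -
  have "circle_cos x < cos (2 * pi * \<theta>)"
    using assms \<theta>_le[OF assms(1)] \<theta>_pos \<theta>_less_half by (simp add: circle_cos_less_iff)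
  then show ?thesis
    using assms(1) poly_B_circle_exp[of x] by (auto simp: nodes_def simp flip: of_real_diff)
qed

text \<open>
  As \<open>B\<close> is its own reversal, \<open>\<bar>B z\<bar>\<^sup>2 = B z * B z / z ^ (N + 1)\<close> on the circle. The denominator
  cancels against the quadratic factor of one of the two copies of \<open>B\<close> and leaves
  \<open>- 2 * B z * C z / z ^ N\<close>.
\<close>

lemma extremal_quotient_eq:
  assumes "x \<noteq> to_circle \<theta>" "x \<noteq> - to_circle \<theta>"
  shows "complex_of_real (extremal_quotient \<mu> N \<theta> x)
    = poly (B * smult (- 2) C) (circle_exp x) * cnj (circle_exp x) ^ N"
proof -
  let ?z = "circle_exp x" and ?k = "circle_cos x - cos (2 * pi * \<theta>)"
  have z: "cmod ?z = 1" by simp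
  have "?k \<noteq> 0"
  proof -
    have "dist x 0 \<noteq> \<theta>" using assms dist_eq_\<theta>D by blast
    then show ?thesis
      using circle_cos_less_iff[of \<theta> x] cos_less_circle_cos_iff[of \<theta> x] \<theta>_pos \<theta>_less_half
      by linarith
  qed
  have B_refl: "poly B ?z = ?z ^ Suc N * cnj (poly B ?z)"
    using star_poly_on_circle[OF z, of B] by (simp add: B_star B_degree)
  have unit: "cnj ?z * ?z = 1"
    using unit_power_mult_cnj[OF z, of 1] by (simp add: mult.commute)
  have "complex_of_real ((cmod (poly B ?z))\<^sup>2) = poly B ?z * cnj (poly B ?z)"
    by (rule complex_norm_square)
  also have "cnj (poly B ?z) = cnj ?z ^ Suc N * poly B ?z"
    by (subst B_refl) simp
  also have "poly B ?z * (cnj ?z ^ Suc N * poly B ?z)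
      = (poly B ?z * cnj ?z ^ Suc N) * (of_real (2 * ?k) * ?z * poly C ?z)"
    by (subst (2) poly_B_circle_exp) (simp add: mult.assoc)
  also have "\<dots> = (cnj ?z * ?z) * (of_real (2 * ?k) * (poly B ?z * poly C ?z * cnj ?z ^ N))"
    by (simp add: mult_ac)
  finally have "complex_of_real ((cmod (poly B ?z))\<^sup>2)
      = of_real (2 * ?k) * (poly B ?z * poly C ?z * cnj ?z ^ N)"
    by (simp only: unit mult_1)
  moreover have "extremal_quotient \<mu> N \<theta> x = (cmod (poly B ?z))\<^sup>2 / (- ?k)"
    by (simp add: extremal_quotient_def B_def)
  ultimately have "complex_of_real (extremal_quotient \<mu> N \<theta> x)
      = of_real (2 * ?k) * (poly B ?z * poly C ?z * cnj ?z ^ N) / of_real (- ?k)"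
    by (simp only: of_real_divide)
  also have "\<dots> = (of_real (2 * ?k) / of_real (- ?k)) * (poly B ?z * poly C ?z * cnj ?z ^ N)"
    by simp
  also have "complex_of_real (2 * ?k) / of_real (- ?k) = - 2"
  proof -
    have "2 * k / (- k) = - 2" if "k \<noteq> 0" for k :: real using that by simp
    then have "2 * ?k / (- ?k) = - 2" using \<open>?k \<noteq> 0\<close> by blast
    then show ?thesis by (simp only: of_real_divide[symmetric]) simp
  qed
  finally show ?thesis by (simp add: mult.assoc)
qed

text \<open>
  The right side of the previous identity is continuous and vanishes at \<open>\<theta>\<close> and \<open>- \<theta>\<close>. The
  limit is determined by it because the circle has no isolated points.
\<close>

lemma extremal_fun_at_\<theta>:
  assumes x: "x = to_circle \<theta> \<or> x = - to_circle \<theta>"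
  shows "extremal_fun \<mu> N \<theta> x = 0"
proof -
  define h where "h y = Re (poly (B * smult (- 2) C) (circle_exp y) * cnj (circle_exp y) ^ N)" for y
  have "continuous_on UNIV h"
    unfolding h_def by (intro continuous_intros continuous_circle_exp)
  then have "(h \<longlongrightarrow> h x) (at x)"
    by (simp add: continuous_on_eq_continuous_at isCont_def)
  moreover have "h x = 0"
    using \<theta>_nodes x by (auto simp: h_def nodes_def)
  moreover have "\<forall>\<^sub>F y in at x. h y = extremal_quotient \<mu> N \<theta> y"
    using eventually_neq_at_within[of "to_circle \<theta>" x UNIV]
      eventually_neq_at_within[of "- to_circle \<theta>" x UNIV]
  proof eventually_elim
    case (elim y)
    then show ?case unfolding h_def extremal_quotient_eq[OF elim, symmetric] by simp
  qed
  ultimately have "(extremal_quotient \<mu> N \<theta> \<longlongrightarrow> 0) (at x)"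
    by (metis Lim_transform_eventually)
  moreover have "\<not> trivial_limit (at x)"
    by (simp add: trivial_limit_within islimpt_add_circle)
  ultimately have "Lim (at x) (extremal_quotient \<mu> N \<theta>) = 0"
    by (intro tendsto_Lim)
  then show ?thesis using x by (auto simp: extremal_fun_def)
qed

lemma extremal_fun_represents: "represents N (B * smult (- 2) C) (extremal_fun \<mu> N \<theta>)"
  unfolding represents_def
proof (intro conjI allI)
  have "degree (smult (- 2) C) = N - 1" by (simp add: C_degree)
  then show "degree (B * smult (- 2) C) \<le> 2 * N"
    using degree_mult_le[of B "smult (- 2) C"] B_degree N_pos by linarith
  fix x
  show "complex_of_real (extremal_fun \<mu> N \<theta> x)
      = poly (B * smult (- 2) C) (circle_exp x) * cnj (circle_exp x) ^ N"
  proof (cases "x = to_circle \<theta> \<or> x = - to_circle \<theta>")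
    case True
    then have "poly B (circle_exp x) = 0" using \<theta>_nodes by (auto simp: nodes_def)
    then show ?thesis using extremal_fun_at_\<theta>[OF True] by simp
  next
    case False
    then show ?thesis using extremal_quotient_eq[of x] by (simp add: extremal_fun_def)
  qed
qed

lemma extremal_fun_nonneg:
  assumes "\<theta> \<le> dist x 0"
  shows "0 \<le> extremal_fun \<mu> N \<theta> x"
proof (cases "dist x 0 = \<theta>")
  case True
  then show ?thesis using extremal_fun_at_\<theta> dist_eq_\<theta>D by simp
next
  case False
  then have "circle_cos x < cos (2 * pi * \<theta>)"
    using assms \<theta>_pos \<theta>_less_half by (simp add: circle_cos_less_iff)
  then show ?thesis
    using False dist_\<theta> by (auto simp: extremal_fun_def extremal_quotient_def)
qed

lemma extremal_fun_neg:
  assumes "dist x 0 < \<theta>"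
  shows "extremal_fun \<mu> N \<theta> x < 0"
proof -
  have off: "x \<noteq> to_circle \<theta>" "x \<noteq> - to_circle \<theta>" using assms dist_\<theta> by auto
  have "cos (2 * pi * \<theta>) < circle_cos x"
    using assms \<theta>_pos \<theta>_less_half by (simp add: cos_less_circle_cos_iff)
  moreover have "poly B (circle_exp x) \<noteq> 0"
    using assms \<theta>_le[of x] by (auto simp: nodes_def)
  ultimately show ?thesis
    using off by (simp add: extremal_fun_def extremal_quotient_def B_def divide_pos_neg)
qed

lemma extremal_fun_admissible: "extremal_fun \<mu> N \<theta> \<in> admissible \<mu> N - {\<lambda>_. 0}"
proof -
  obtain w where w: "\<And>f G. represents N G f \<Longrightarrow> (LINT x|\<mu>. f x) = (\<Sum>x\<in>nodes. w x * f x)"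
    using quadrature by auto
  have "extremal_fun \<mu> N \<theta> x = 0" if "x \<in> nodes" for x
  proof -
    have "complex_of_real (extremal_fun \<mu> N \<theta> x) = 0"
      using that extremal_fun_represents by (simp add: represents_def nodes_def)
    then show ?thesis by simp
  qed
  then have "(LINT x|\<mu>. extremal_fun \<mu> N \<theta> x) = 0"
    using w[OF extremal_fun_represents] by simp
  moreover have "extremal_fun \<mu> N \<theta> 0 \<noteq> 0"
    using extremal_fun_neg[of 0] \<theta>_pos by simp
  ultimately show ?thesis
    using represents_imp_trig_poly[OF extremal_fun_represents]
    by (auto simp: admissible_def eventually_nonneg_add_circle fun_eq_iff)
qed

lemma last_sign_change_extremal_fun: "last_sign_change (extremal_fun \<mu> N \<theta>) = \<theta>"
proof -
  have "nonneg_radii (extremal_fun \<mu> N \<theta>) = {\<theta>..}"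
  proof (intro equalityI subsetI)
    fix r assume "r \<in> {\<theta>..}"
    then show "r \<in> nonneg_radii (extremal_fun \<mu> N \<theta>)"
      using \<theta>_pos extremal_fun_nonneg by (auto simp: nonneg_radii_def dist_commute)
  next
    fix r assume r: "r \<in> nonneg_radii (extremal_fun \<mu> N \<theta>)"
    show "r \<in> {\<theta>..}"
    proof (rule ccontr)
      assume "r \<notin> {\<theta>..}"
      then have "dist (to_circle r) 0 = r" "r < \<theta>"
        using r \<theta>_less_half by (auto simp: nonneg_radii_def dist_to_circle_zero int_dist_eq_self)
      then show False
        using r extremal_fun_neg[of "to_circle r"]
        by (auto simp: nonneg_radii_def dist_commute dest!: spec[of _ "to_circle r"])
    qed
  qed
  then show ?thesis by (simp add: last_sign_change_eq)
qed

lemma rho_eq_\<theta>: "rho \<mu> N = \<theta>"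
  unfolding rho_def
proof (rule cInf_eq_minimum)
  show "\<theta> \<in> last_sign_change ` (admissible \<mu> N - {\<lambda>_. 0})"
    using extremal_fun_admissible last_sign_change_extremal_fun by (metis imageI)
qed (use \<theta>_le_last_sign_change in auto)

lemma extremizer_extremal_fun: "extremizer \<mu> N (extremal_fun \<mu> N \<theta>)"
  unfolding extremizer_def
  using extremal_fun_admissible last_sign_change_extremal_fun rho_eq_\<theta> by simp

text \<open>
  Any extremizer is \<open>B * H\<close> with \<open>degree H < N\<close>, and \<open>H\<close> vanishes at the \<open>N - 1\<close> roots of \<open>C\<close>.
  Scaling \<open>C\<close> so that it agrees with \<open>H\<close> at \<open>\<theta>\<close> gives agreement at \<open>N\<close> points, so
  \<open>H\<close> is a multiple of \<open>C\<close>.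
\<close>

lemma extremizer_unique:
  assumes "extremizer \<mu> N g"
  shows "\<exists>c. g = (\<lambda>x. c * extremal_fun \<mu> N \<theta> x)"
proof -
  have g: "g \<in> admissible \<mu> N" "last_sign_change g = \<theta>"
    using assms rho_eq_\<theta> by (auto simp: extremizer_def)
  have "0 \<le> g x" if "\<theta> < dist x 0" for x
    using nonneg_beyond_last_sign_change[of g "dist x 0"] g(2) that by (metis less_imp_le)
  then obtain H where H: "represents N (B * H) g" "degree H < N"
      "\<And>x. x \<in> nodes \<Longrightarrow> \<theta> < dist x 0 \<Longrightarrow> poly H (circle_exp x) = 0"
    using competitor_factorization[OF g(1), of \<theta>] \<theta>_pos by auto
  define a where "a = circle_exp (to_circle \<theta>)"
  define k where "k = poly H a / poly C a"
  have "H = smult k C"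
  proof (rule poly_eqI_degree[where A = "circle_exp ` (nodes - {- to_circle \<theta>})"])
    fix b assume "b \<in> circle_exp ` (nodes - {- to_circle \<theta>})"
    then obtain x where x: "x \<in> nodes" "x \<noteq> - to_circle \<theta>" "b = circle_exp x" by auto
    show "poly H b = poly (smult k C) b"
    proof (cases "dist x 0 = \<theta>")
      case True
      then have "x = to_circle \<theta>" using x dist_eq_\<theta>D by blast
      then have "b = a" by (simp only: a_def x)
      then show ?thesis using C_at_\<theta> by (simp add: k_def a_def)
    next
      case False
      then show ?thesis using x \<theta>_le[of x] H(3)[of x] C_at_other_nodes[of x] by simp
    qed
  next
    have card: "card (circle_exp ` (nodes - {- to_circle \<theta>})) = N"
      using \<theta>_nodes finite_nodes by (simp add: card_image[OF inj_on_circle_exp] card_nodes)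
    then show "degree H < card (circle_exp ` (nodes - {- to_circle \<theta>}))" using H(2) by simp
    show "degree (smult k C) < card (circle_exp ` (nodes - {- to_circle \<theta>}))"
      using degree_smult_le[of k C] card N_pos by (simp add: C_degree)
  qed
  then have eq: "complex_of_real (g x) = - (k / 2) * of_real (extremal_fun \<mu> N \<theta> x)" for x
    using H(1) extremal_fun_represents by (simp add: represents_def)
  \<comment> \<open>the factor is real, because both functions are real and the extremal function is negative at \<open>0\<close>\<close>
  define c where "c = g 0 / extremal_fun \<mu> N \<theta> 0"
  have "extremal_fun \<mu> N \<theta> 0 \<noteq> 0" using extremal_fun_neg[of 0] \<theta>_pos by simp
  then have "- (k / 2) = of_real c"
    using eq[of 0] by (simp add: c_def)
  then have "complex_of_real (g x) = of_real (c * extremal_fun \<mu> N \<theta> x)" for x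
    by (simp only: eq of_real_mult)
  then have "g x = c * extremal_fun \<mu> N \<theta> x" for x
    unfolding of_real_eq_iff .
  then have "g = (\<lambda>x. c * extremal_fun \<mu> N \<theta> x)" by (rule ext)
  then show ?thesis by blast
qed

end

theorem theorem1:
  fixes \<mu> :: "add_circle measure" and N :: nat
  assumes "finite_measure \<mu>"
    and "sets \<mu> = sets borel"
    and "\<And>A. A \<in> sets borel \<Longrightarrow> emeasure \<mu> A = emeasure \<mu> (uminus ` A)"
  shows
    "(1 \<le> N \<and> enat N < supp_size \<mu> \<longrightarrow>
       (\<exists>\<theta>\<^sub>1. 0 \<le> \<theta>\<^sub>1 \<and> \<theta>\<^sub>1 \<le> 1 / 2 \<and>
          poly (A_poly \<mu> (N + 1)) (cis (2 * pi * \<theta>\<^sub>1)) = 0 \<and>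
          (\<forall>\<theta>. poly (A_poly \<mu> (N + 1)) (circle_exp \<theta>) = 0 \<longrightarrow> \<theta>\<^sub>1 \<le> dist \<theta> 0) \<and>
          rho \<mu> N = \<theta>\<^sub>1 \<and>
          extremizer \<mu> N (extremal_fun \<mu> N \<theta>\<^sub>1) \<and>
          (\<forall>g. extremizer \<mu> N g \<longrightarrow> (\<exists>c. g = (\<lambda>x. c * extremal_fun \<mu> N \<theta>\<^sub>1 x))))) \<and>
     (1 \<le> N \<and> supp_size \<mu> \<le> enat N \<longrightarrow> rho \<mu> N = 0)"
proof -
  interpret finite_measure \<mu> by fact
  interpret even_circle_measure \<mu> by unfold_locales (use assms in auto)
  show ?thesis
  proof (intro conjI impI)
    assume N: "1 \<le> N \<and> enat N < supp_size \<mu>"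
    then interpret extremal_problem \<mu> N by unfold_locales auto
    have "poly (A_poly \<mu> (N + 1)) (cis (2 * pi * \<theta>)) = 0"
      using \<theta>_nodes(1) by (simp add: nodes_def B_def)
    moreover have "\<forall>x. poly (A_poly \<mu> (N + 1)) (circle_exp x) = 0 \<longrightarrow> \<theta> \<le> dist x 0"
      using \<theta>_le by (simp add: nodes_def B_def)
    ultimately show "\<exists>\<theta>\<^sub>1. 0 \<le> \<theta>\<^sub>1 \<and> \<theta>\<^sub>1 \<le> 1 / 2 \<and>
          poly (A_poly \<mu> (N + 1)) (cis (2 * pi * \<theta>\<^sub>1)) = 0 \<and>
          (\<forall>\<theta>. poly (A_poly \<mu> (N + 1)) (circle_exp \<theta>) = 0 \<longrightarrow> \<theta>\<^sub>1 \<le> dist \<theta> 0) \<and>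
          rho \<mu> N = \<theta>\<^sub>1 \<and>
          extremizer \<mu> N (extremal_fun \<mu> N \<theta>\<^sub>1) \<and>
          (\<forall>g. extremizer \<mu> N g \<longrightarrow> (\<exists>c. g = (\<lambda>x. c * extremal_fun \<mu> N \<theta>\<^sub>1 x)))"
      using \<theta>_pos \<theta>_less_half rho_eq_\<theta> extremizer_extremal_fun extremizer_unique
      by (intro exI[of _ \<theta>]) auto
  qed (simp add: rho_eq_zero_if_supp_size_le)
qed

end
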